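(* Let $n\ge3$, let $U^n\subset\mathbf{R}^n$ be a domain and $f\colon U^n\to(\mathbf{R}^{n+1},g_0)$ a front whose singular points are all cuspidal edges. If the sectional curvature $K$ at the regular points is bounded, then the second fundamental form of $f$ vanishes on the singular submanifold. Moreover, if $K$ is positive everywhere on the regular set, then the sectional curvature of the singular submanifold is non-negative. Furthermore, if $K\ge\delta$ on the regular set for some constant $\delta>0$, then the sectional curvature of the singular submanifold is positive.
   Context: All objects are $C^\infty$; $g_0$ is the Euclidean metric. Let $(u_1,\dots,u_n)$ be the coordinates of $\mathbf{R}^n$. A smooth map $f\colon U^n\to\mathbf{R}^{n+1}$ is a front if there is a unit vector field $\nu$ along $f$ with $g_0(f_*X,\nu)=0$ for all $X\in TU^n$ and such that $(f,\nu)\colon U^n\to\mathbf{R}^{n+1}\times S^n$ is an immersion. Put $\lambda=\det(f_{u_1},\dots,f_{u_n},\nu)$. A point is singular if $f$ is not an immersion there, regular otherwise; a singular point is non-degenerate if $d\lambda\ne0$ there. Near a non-degenerate singular point the singular set is an $(n-1)$-dimensional submanifold, the singular submanifold, and the kernel of $f_*$ at such a point is one-dimensional, called the null direction. A cuspidal edge is a non-degenerate singular point at which the null direction is transversal to the singular submanifold (so $f$ restricted to the singular submanifold is an immersion). The second fundamental form of $f$ is $h(X,Y)=-g_0(f_*X,D_Y\nu)$, where $D$ is the flat connection of $\mathbf{R}^{n+1}$. $K$ denotes the sectional curvature of the induced metric $f^*g_0$ on the regular set (for all tangent $2$-planes), and the sectional curvature of the singular submanifold is that of the metric induced on it by the immersion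 $f$ restricted to it. *)

theory Defs
  imports "HOL-Analysis.Analysis"
begin

text \<open>The notions below are meant for open \<open>U\<close>; values of maps outside \<open>U\<close> are irrelevant.\<close>

primrec Ck_on :: "nat \<Rightarrow> 'a::real_normed_vector set \<Rightarrow> ('a \<Rightarrow> 'b::real_normed_vector) \<Rightarrow> bool" where
  "Ck_on 0 U f \<longleftrightarrow> continuous_on U f"
| "Ck_on (Suc k) U f \<longleftrightarrow> (\<forall>x\<in>U. f differentiable (at x)) \<and>
     (\<forall>v. Ck_on k U (\<lambda>x. frechet_derivative f (at x) v))"

definition smooth_on :: "'a::real_normed_vector set \<Rightarrow> ('a \<Rightarrow> 'b::real_normed_vector) \<Rightarrow> bool" where
  "smooth_on U f \<longleftrightarrow> (\<forall>k. Ck_on k U f)"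

definition partial_deriv :: "'n::finite \<Rightarrow> (real^'n \<Rightarrow> 'b::real_normed_vector) \<Rightarrow> real^'n \<Rightarrow> 'b" where
  "partial_deriv i f u = frechet_derivative f (at u) (axis i 1)"

definition immersion_at :: "('a::real_normed_vector \<Rightarrow> 'b::real_normed_vector) \<Rightarrow> 'a \<Rightarrow> bool" where
  "immersion_at f u \<longleftrightarrow> f differentiable (at u) \<and> inj (frechet_derivative f (at u))"

definition singular_set :: "'a::real_normed_vector set \<Rightarrow> ('a \<Rightarrow> 'b::real_normed_vector) \<Rightarrow> 'a set" where
  "singular_set U f = {u \<in> U. \<not> immersion_at f u}"

definition regular_set :: "'a::real_normed_vector set \<Rightarrow> ('a \<Rightarrow> 'b::real_normed_vector) \<Rightarrow> 'a set" where
  "regular_set U f = {u \<in> U. immersion_at f u}"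

text \<open>
  If \<open>'n\<close> indexes the coordinates of \<open>\<real>\<^sup>n\<close>, then \<open>'n option\<close> indexes those of
  \<open>\<real>\<^sup>n\<^sup>+\<^sup>1\<close>, with \<open>None\<close> as the last index.
\<close>

definition front_with :: "(real^'n) set \<Rightarrow> (real^'n::finite \<Rightarrow> real^('n option)) \<Rightarrow>
    (real^'n \<Rightarrow> real^('n option)) \<Rightarrow> bool" where
  "front_with U f \<nu> \<longleftrightarrow> smooth_on U f \<and> smooth_on U \<nu> \<and>
     (\<forall>u\<in>U. norm (\<nu> u) = 1) \<and>
     (\<forall>u\<in>U. \<forall>x. frechet_derivative f (at u) x \<bullet> \<nu> u = 0) \<and>
     (\<forall>u\<in>U. immersion_at (\<lambda>w. (f w, \<nu> w)) u)"

text \<open>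
  The determinant of the matrix with columns \<open>f\<^bsub>u1\<^esub>, \<dots>, f\<^bsub>un\<^esub>, \<nu>\<close>.  Rows and columns
  are indexed by the same type, so it does not depend on an enumeration of \<open>'n\<close>.
\<close>

definition signed_density :: "(real^'n::finite \<Rightarrow> real^('n option)) \<Rightarrow>
    (real^'n \<Rightarrow> real^('n option)) \<Rightarrow> real^'n \<Rightarrow> real" where
  "signed_density f \<nu> u =
     det (\<chi> a b. (case b of Some i \<Rightarrow> partial_deriv i f u | None \<Rightarrow> \<nu> u) $ a)"

definition nondegenerate_singular_point :: "(real^'n) set \<Rightarrow> (real^'n::finite \<Rightarrow> real^('n option)) \<Rightarrow>
    (real^'n \<Rightarrow> real^('n option)) \<Rightarrow> real^'n \<Rightarrow> bool" where
  "nondegenerate_singular_point U f \<nu> u \<longleftrightarrow> u \<in> singular_set U f \<and>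
     frechet_derivative (signed_density f \<nu>) (at u) \<noteq> (\<lambda>x. 0)"

text \<open>The tangent space of a submanifold: velocities of smooth curves lying in it.\<close>

definition tangent_space :: "'a::real_normed_vector set \<Rightarrow> 'a \<Rightarrow> 'a set" where
  "tangent_space S p = {v. \<exists>c. \<exists>\<epsilon>>0. smooth_on {-\<epsilon><..<\<epsilon>} c \<and> c ` {-\<epsilon><..<\<epsilon>} \<subseteq> S \<and>
     c 0 = p \<and> (c has_vector_derivative v) (at (0::real))}"

definition null_space :: "('a::real_normed_vector \<Rightarrow> 'b::real_normed_vector) \<Rightarrow> 'a \<Rightarrow> 'a set" where
  "null_space f u = {v. frechet_derivative f (at u) v = 0}"

definition cuspidal_edge :: "(real^'n) set \<Rightarrow> (real^'n::finite \<Rightarrow> real^('n option)) \<Rightarrow>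
    (real^'n \<Rightarrow> real^('n option)) \<Rightarrow> real^'n \<Rightarrow> bool" where
  "cuspidal_edge U f \<nu> u \<longleftrightarrow> nondegenerate_singular_point U f \<nu> u \<and>
     {v + w | v w. v \<in> null_space f u \<and> w \<in> tangent_space (singular_set U f) u} = UNIV"

definition second_fundamental_form :: "('a::real_normed_vector \<Rightarrow> 'b::real_inner) \<Rightarrow> ('a \<Rightarrow> 'b) \<Rightarrow>
    'a \<Rightarrow> 'a \<Rightarrow> 'a \<Rightarrow> real" where
  "second_fundamental_form f \<nu> u x y =
     - (frechet_derivative f (at u) x \<bullet> frechet_derivative \<nu> (at u) y)"

text \<open>The Riemannian curvature of a metric given by its Gram matrix \<open>g u\<close> in coordinates.\<close>

definition christoffel :: "(real^'m::finite \<Rightarrow> real^'m^'m) \<Rightarrow> 'm \<Rightarrow> 'm \<Rightarrow> 'm \<Rightarrow> real^'m \<Rightarrow> real" where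
  "christoffel g l i j u = (1/2) * (\<Sum>s\<in>UNIV. matrix_inv (g u) $ l $ s *
     (partial_deriv i (\<lambda>w. g w $ j $ s) u + partial_deriv j (\<lambda>w. g w $ i $ s) u
      - partial_deriv s (\<lambda>w. g w $ i $ j) u))"

text \<open>
  \<open>riemann g l i j k u\<close> is the \<open>\<partial>\<^sub>l\<close>-component of \<open>R(\<partial>\<^sub>i,\<partial>\<^sub>j)\<partial>\<^sub>k\<close>, where
  \<open>R(X,Y) = \<nabla>\<^sub>X\<nabla>\<^sub>Y - \<nabla>\<^sub>Y\<nabla>\<^sub>X - \<nabla>\<^bsub>[X,Y]\<^esub>\<close>.
\<close>

definition riemann :: "(real^'m::finite \<Rightarrow> real^'m^'m) \<Rightarrow> 'm \<Rightarrow> 'm \<Rightarrow> 'm \<Rightarrow> 'm \<Rightarrow> real^'m \<Rightarrow> real" where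
  "riemann g l i j k u =
     partial_deriv i (christoffel g l j k) u - partial_deriv j (christoffel g l i k) u
     + (\<Sum>s\<in>UNIV. christoffel g l i s u * christoffel g s j k u
                 - christoffel g l j s u * christoffel g s i k u)"

definition curvature_operator :: "(real^'m::finite \<Rightarrow> real^'m^'m) \<Rightarrow> real^'m \<Rightarrow>
    real^'m \<Rightarrow> real^'m \<Rightarrow> real^'m \<Rightarrow> real^'m" where
  "curvature_operator g u x y z =
     (\<chi> l. \<Sum>i\<in>UNIV. \<Sum>j\<in>UNIV. \<Sum>k\<in>UNIV. riemann g l i j k u * x $ i * y $ j * z $ k)"

definition metric_at :: "(real^'m::finite \<Rightarrow> real^'m^'m) \<Rightarrow> real^'m \<Rightarrow> real^'m \<Rightarrow> real^'m \<Rightarrow> real" where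
  "metric_at g u x y = x \<bullet> (g u *v y)"

text \<open>Meaningful when \<open>x\<close> and \<open>y\<close> are linearly independent; depends only on the plane they span.\<close>

definition sectional_curvature :: "(real^'m::finite \<Rightarrow> real^'m^'m) \<Rightarrow> real^'m \<Rightarrow>
    real^'m \<Rightarrow> real^'m \<Rightarrow> real" where
  "sectional_curvature g u x y =
     metric_at g u (curvature_operator g u x y y) x /
     (metric_at g u x x * metric_at g u y y - (metric_at g u x y)\<^sup>2)"

definition spans_plane :: "'a::real_vector \<Rightarrow> 'a \<Rightarrow> bool" where
  "spans_plane x y \<longleftrightarrow> x \<noteq> y \<and> independent {x, y}"

definition induced_metric :: "(real^'m::finite \<Rightarrow> 'b::real_inner) \<Rightarrow> real^'m \<Rightarrow> real^'m^'m" where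
  "induced_metric F u = (\<chi> i j. partial_deriv i F u \<bullet> partial_deriv j F u)"

text \<open>
  The induced geometry of a submanifold \<open>S\<close> is read off in local parametrizations
  \<open>\<phi>\<close>: for \<open>F\<close> defined on the ambient space, the metric that \<open>F\<close> induces on \<open>S\<close>
  is \<open>induced_metric (F \<circ> \<phi>)\<close> in the coordinates of \<open>V\<close>.
\<close>

definition local_parametrization :: "'b::real_normed_vector set \<Rightarrow> 'a::real_normed_vector set \<Rightarrow>
    ('a \<Rightarrow> 'b) \<Rightarrow> bool" where
  "local_parametrization S V \<phi> \<longleftrightarrow> open V \<and> smooth_on V \<phi> \<and> (\<forall>q\<in>V. immersion_at \<phi> q) \<and>
     openin (top_of_set S) (\<phi> ` V) \<and> (\<exists>\<psi>. homeomorphism V (\<phi> ` V) \<phi> \<psi>)"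

end

theory Submission
  imports Defs
begin

text \<open>
  At a singular point \<open>u\<close> choose \<open>e\<close> with \<open>df e = 0\<close>; transversality allows \<open>d\<rho> e \<noteq> 0\<close> for the density
  \<open>\<rho> = det (f\<^bsub>u1\<^esub>, \<dots>, f\<^bsub>un\<^esub>, \<nu>)\<close>.  The form \<open>h\<close> is symmetric, so \<open>h(e, \<cdot>) = 0\<close> at \<open>u\<close>, and \<open>d\<nu> e\<close> is a
  nonzero vector orthogonal to \<open>\<nu>\<close> and to the image of \<open>df\<close>.  Comparing with \<open>d\<rho> e\<close> shows that
  \<open>h(e,e)\<close> has nonzero derivative \<open>c\<close> in direction \<open>e\<close>.  By the Gauss equation
  \<open>h(x,x) h(e,e) - h(x,e)\<^sup>2\<close> is \<open>K\<close> times a Gram determinant that vanishes to second order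
  along \<open>u + t e\<close>, while the left hand side is \<open>t c h(x,x) + o(t)\<close>.  Bounded \<open>K\<close> therefore gives
  \<open>h(x,x) = 0\<close>, and so does positive \<open>K\<close>, since then the left hand side is positive for both signs of \<open>t\<close>.

  Once \<open>h\<close> vanishes on the singular set, \<open>h = t h' + o(t)\<close> along \<open>u + t e\<close>, so positivity of \<open>K\<close> gives
  \<open>h'(x,x) h'(y,y) - h'(x,y)\<^sup>2 \<ge> 0\<close>.  For tangent vectors of the singular set \<open>h'\<close> is the
  \<open>d\<nu> e\<close>-component of the second fundamental form of its image, whose \<open>\<nu>\<close>-component vanishes; so up
  to positive factors this minor is the curvature of the singular set.  Moreover \<open>K\<close> tends to \<open>0\<close> along
  \<open>u + t e\<close> on planes spanned by tangent vectors of the singular set, so \<open>K \<ge> \<delta> > 0\<close> excludes singular points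
  altogether.
\<close>

section \<open>Smooth maps\<close>

lemma has_vector_derivative_along_line:
  fixes f :: "'a::real_normed_vector \<Rightarrow> 'b::real_normed_vector"
  assumes "f differentiable (at (a + s *\<^sub>R v))"
  shows "((\<lambda>s. f (a + s *\<^sub>R v)) has_vector_derivative frechet_derivative f (at (a + s *\<^sub>R v)) v) (at s)"
proof -
  have f: "(f has_derivative frechet_derivative f (at (a + s *\<^sub>R v))) (at (a + s *\<^sub>R v))"
    using assms frechet_derivative_works by blast
  have g: "((\<lambda>s. a + s *\<^sub>R v) has_derivative (\<lambda>h. h *\<^sub>R v)) (at s)"
    by (auto intro!: derivative_eq_intros)
  show ?thesis
    using has_derivative_compose[OF g f] linear_scale[OF linear_frechet_derivative[OF assms]]
    by (simp add: has_vector_derivative_def)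
qed

text \<open>On an open \<open>U\<close> the two maps agree near each point, so their derivatives
  agree on \<open>U\<close> and the induction passes to them. The closure lemmas below use this to
  replace a derivative by its formula.\<close>

lemma Ck_on_cong:
  fixes f g :: "'a::real_normed_vector \<Rightarrow> 'b::real_normed_vector"
  assumes "open U" "\<And>x. x \<in> U \<Longrightarrow> f x = g x" "Ck_on k U f"
  shows "Ck_on k U g"
  using assms(2,3)
proof (induction k arbitrary: f g)
  case 0
  then show ?case by (simp cong: continuous_on_cong)
next
  case (Suc k)
  have d: "f differentiable (at x) \<Longrightarrow> g differentiable (at x)"
    and e: "f differentiable (at x) \<Longrightarrow> frechet_derivative f (at x) = frechet_derivative g (at x)"
    if "x \<in> U" for x
    using that Suc.prems(1) assms(1) has_derivative_transform_within_open[of f _ x UNIV U g]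
      frechet_derivative_transform_within_open[of f x U g] unfolding differentiable_def
    by blast+
  show ?case
    using Suc.prems(2) d e Suc.IH[of "\<lambda>x. frechet_derivative f (at x) v" "\<lambda>x. frechet_derivative g (at x) v" for v]
    by (simp add: d e)
qed

text \<open>Lowers the undifferentiated factors in the product and chain rules to the order of the
  differentiated ones.\<close>

lemma Ck_on_SucD:
  fixes f :: "'a::real_normed_vector \<Rightarrow> 'b::real_normed_vector"
  assumes "Ck_on (Suc k) U f"
  shows "Ck_on k U f"
  using assms
proof (induction k arbitrary: f)
  case 0
  then show ?case
    by (auto intro!: continuous_at_imp_continuous_on differentiable_imp_continuous_within)
next
  case (Suc k)
  then show ?case by (simp only: Ck_on.simps(2)) blast
qed

lemma Ck_on_const: "Ck_on k U (\<lambda>x. c)"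
  by (induction k arbitrary: c) auto

lemma Ck_on_bounded_linear:
  fixes f :: "'a::real_normed_vector \<Rightarrow> 'b::real_normed_vector"
  assumes "open U" "bounded_linear L" "Ck_on k U f"
  shows "Ck_on k U (\<lambda>x. L (f x))"
  using assms(3)
proof (induction k arbitrary: f)
  case 0
  then show ?case
    using bounded_linear.continuous_on[OF assms(2)] by simp
next
  case (Suc k)
  have d: "((\<lambda>x. L (f x)) has_derivative (\<lambda>v. L (frechet_derivative f (at x) v))) (at x)" if "x \<in> U" for x
    using Suc.prems that by (auto intro!: bounded_linear.has_derivative[OF assms(2)] simp: frechet_derivative_works[symmetric])
  show ?case
    unfolding Ck_on.simps
  proof (intro conjI ballI allI)
    show "(\<lambda>x. L (f x)) differentiable (at x)" if "x \<in> U" for x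
      using d[OF that] by (auto simp: differentiable_def)
    show "Ck_on k U (\<lambda>x. frechet_derivative (\<lambda>x. L (f x)) (at x) v)" for v
      by (rule Ck_on_cong[OF assms(1) _ Suc.IH[of "\<lambda>x. frechet_derivative f (at x) v"]])
         (use Suc.prems frechet_derivative_at[OF d] in \<open>auto dest: fun_cong\<close>)
  qed
qed

lemma Ck_on_add:
  fixes f g :: "'a::real_normed_vector \<Rightarrow> 'b::real_normed_vector"
  assumes "open U" "Ck_on k U f" "Ck_on k U g"
  shows "Ck_on k U (\<lambda>x. f x + g x)"
  using assms(2,3)
proof (induction k arbitrary: f g)
  case 0
  then show ?case by (simp add: continuous_on_add)
next
  case (Suc k)
  have d: "((\<lambda>x. f x + g x) has_derivative (\<lambda>v. frechet_derivative f (at x) v + frechet_derivative g (at x) v)) (at x)" if "x \<in> U" for x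
    using Suc.prems that by (auto intro!: has_derivative_add simp: frechet_derivative_works[symmetric])
  show ?case
    unfolding Ck_on.simps
  proof (intro conjI ballI allI)
    show "(\<lambda>x. f x + g x) differentiable (at x)" if "x \<in> U" for x
      using d[OF that] by (auto simp: differentiable_def)
    show "Ck_on k U (\<lambda>x. frechet_derivative (\<lambda>x. f x + g x) (at x) v)" for v
      by (rule Ck_on_cong[OF assms(1) _ Suc.IH[of "\<lambda>x. frechet_derivative f (at x) v" "\<lambda>x. frechet_derivative g (at x) v"]])
         (use Suc.prems frechet_derivative_at[OF d] in \<open>auto dest: fun_cong\<close>)
  qed
qed

lemma Ck_on_sum:
  fixes f :: "'i \<Rightarrow> 'a::real_normed_vector \<Rightarrow> 'b::real_normed_vector"
  assumes "open U" "\<And>i. i \<in> I \<Longrightarrow> Ck_on k U (f i)"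
  shows "Ck_on k U (\<lambda>x. \<Sum>i\<in>I. f i x)"
  using assms(2)
  by (induction I rule: infinite_finite_induct) (simp_all add: Ck_on_const Ck_on_add assms(1))

lemma Ck_on_scaleR:
  fixes f :: "'a::real_normed_vector \<Rightarrow> 'b::real_normed_vector"
  assumes "open U" "Ck_on k U a" "Ck_on k U f"
  shows "Ck_on k U (\<lambda>x. a x *\<^sub>R f x)"
  using assms(2,3)
proof (induction k arbitrary: a f)
  case 0
  then show ?case by (simp add: continuous_on_scaleR)
next
  case (Suc k)
  have d: "((\<lambda>x. a x *\<^sub>R f x) has_derivative (\<lambda>v. a x *\<^sub>R frechet_derivative f (at x) v + frechet_derivative a (at x) v *\<^sub>R f x)) (at x)" if "x \<in> U" for x
    using Suc.prems that by (auto intro!: has_derivative_scaleR simp: frechet_derivative_works[symmetric])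
  show ?case
    unfolding Ck_on.simps
  proof (intro conjI ballI allI)
    show "(\<lambda>x. a x *\<^sub>R f x) differentiable (at x)" if "x \<in> U" for x
      using d[OF that] by (auto simp: differentiable_def)
    have "Ck_on k U (\<lambda>x. a x *\<^sub>R frechet_derivative f (at x) v + frechet_derivative a (at x) v *\<^sub>R f x)" for v
      using Suc.prems Ck_on_SucD[OF Suc.prems(1)] Ck_on_SucD[OF Suc.prems(2)]
      by (auto intro!: Ck_on_add assms(1) Suc.IH)
    then show "Ck_on k U (\<lambda>x. frechet_derivative (\<lambda>x. a x *\<^sub>R f x) (at x) v)" for v
      by (rule Ck_on_cong[OF assms(1), rotated])
         (use frechet_derivative_at[OF d] in \<open>auto dest: fun_cong\<close>)
  qed
qed

lemma frechet_derivative_partials: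
  fixes f :: "real^'n::finite \<Rightarrow> 'b::real_normed_vector"
  assumes "f differentiable (at u)"
  shows "frechet_derivative f (at u) v = (\<Sum>i\<in>UNIV. v $ i *\<^sub>R partial_deriv i f u)"
proof -
  note l = linear_frechet_derivative[OF assms]
  have "frechet_derivative f (at u) v = frechet_derivative f (at u) (\<Sum>i\<in>UNIV. v $ i *\<^sub>R axis i 1)"
    by (simp add: basis_expansion scalar_mult_eq_scaleR[symmetric])
  then show ?thesis
    by (simp add: linear_sum[OF l] linear_scale[OF l] partial_deriv_def)
qed

lemma frechet_derivative_comp:
  assumes "g differentiable (at x)" "f differentiable (at (g x))"
  shows "(f \<circ> g) differentiable (at x)"
    and "frechet_derivative (f \<circ> g) (at x) v = frechet_derivative f (at (g x)) (frechet_derivative g (at x) v)"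
  using assms differentiable_chain_at frechet_derivative_compose[OF assms] by auto

text \<open>Expanded in partial derivatives, the chain rule is a finite sum of products of scalar
  functions with the maps \<open>partial_deriv i f \<circ> \<phi>\<close>, to which the induction
  hypothesis applies.\<close>

lemma Ck_on_comp:
  fixes \<phi> :: "'a::real_normed_vector \<Rightarrow> real^'n::finite" and f :: "real^'n \<Rightarrow> 'b::real_normed_vector"
  assumes "open V" "Ck_on k V \<phi>" "Ck_on k U f" "\<phi> ` V \<subseteq> U"
  shows "Ck_on k V (f \<circ> \<phi>)"
  using assms(2,3)
proof (induction k arbitrary: f)
  case 0
  then show ?case using assms(4) continuous_on_compose continuous_on_subset by (metis Ck_on.simps(1))
next
  case (Suc k)
  have df: "f differentiable (at (\<phi> x))" and dp: "\<phi> differentiable (at x)" if "x \<in> V" for x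
    using Suc.prems assms(4) that by auto
  show ?case
    unfolding Ck_on.simps
  proof (intro conjI ballI allI)
    show "(f \<circ> \<phi>) differentiable (at x)" if "x \<in> V" for x
      using df[OF that] dp[OF that] frechet_derivative_comp(1) by blast
    fix v
    have "Ck_on k V (\<lambda>x. \<Sum>i\<in>UNIV. (frechet_derivative \<phi> (at x) v $ i) *\<^sub>R (partial_deriv i f \<circ> \<phi>) x)"
    proof (intro Ck_on_sum Ck_on_scaleR assms(1))
      fix i
      show "Ck_on k V (\<lambda>x. frechet_derivative \<phi> (at x) v $ i)"
        using Suc.prems(1) by (auto intro: Ck_on_bounded_linear[OF assms(1) bounded_linear_vec_nth])
      show "Ck_on k V (partial_deriv i f \<circ> \<phi>)"
        using Suc.prems Ck_on_SucD[OF Suc.prems(1)] by (intro Suc.IH) (auto simp: partial_deriv_def[abs_def])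
    qed
    then show "Ck_on k V (\<lambda>x. frechet_derivative (f \<circ> \<phi>) (at x) v)"
      by (rule Ck_on_cong[OF assms(1), rotated])
         (simp add: frechet_derivative_comp(2)[OF dp df] frechet_derivative_partials[OF df])
  qed
qed

lemma smooth_on_comp:
  fixes \<phi> :: "'a::real_normed_vector \<Rightarrow> real^'n::finite" and f :: "real^'n \<Rightarrow> 'b::real_normed_vector"
  assumes "open V" "smooth_on V \<phi>" "smooth_on U f" "\<phi> ` V \<subseteq> U"
  shows "smooth_on V (f \<circ> \<phi>)"
  using assms Ck_on_comp[OF assms(1)] unfolding smooth_on_def by blast

lemma smooth_on_differentiable: "smooth_on U f \<Longrightarrow> x \<in> U \<Longrightarrow> f differentiable (at x)"
  unfolding smooth_on_def by (metis Ck_on.simps(2))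

lemma smooth_on_frechet_derivative: "smooth_on U f \<Longrightarrow> smooth_on U (\<lambda>x. frechet_derivative f (at x) v)"
  unfolding smooth_on_def by (metis Ck_on.simps(2))

lemma smooth_on_inner_const:
  fixes f :: "'a::real_normed_vector \<Rightarrow> 'b::real_inner"
  assumes "open U" "smooth_on U f"
  shows "smooth_on U (\<lambda>x. f x \<bullet> c)"
  using assms Ck_on_bounded_linear[OF assms(1) bounded_linear_inner_left] unfolding smooth_on_def by blast

section \<open>Symmetry of second derivatives\<close>

text \<open>The mean value theorem is applied first in direction \<open>v\<close>, then in direction
  \<open>w\<close>. The second difference on the left is symmetric in \<open>v\<close> and
  \<open>w\<close>, which is what the next lemma exploits.\<close>

lemma second_difference_mean_value:
  fixes f :: "'a::real_normed_vector \<Rightarrow> real"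
  assumes "smooth_on U f" "h > 0"
    and sub: "\<And>s t. \<lbrakk>0 \<le> s; s \<le> h; 0 \<le> t; t \<le> h\<rbrakk> \<Longrightarrow> p + s *\<^sub>R v + t *\<^sub>R w \<in> U"
  shows "\<exists>s t. 0 < s \<and> s < h \<and> 0 < t \<and> t < h \<and>
     f (p + h *\<^sub>R v + h *\<^sub>R w) - f (p + h *\<^sub>R v) - f (p + h *\<^sub>R w) + f p
       = h * (h * frechet_derivative (\<lambda>x. frechet_derivative f (at x) v) (at (p + s *\<^sub>R v + t *\<^sub>R w)) w)"
proof -
  let ?g = "\<lambda>x. frechet_derivative f (at x) v"
  have line: "((\<lambda>s. g (a + s *\<^sub>R e)) has_real_derivative frechet_derivative g (at (a + s *\<^sub>R e)) e) (at s)"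
    if "smooth_on U g" "a + s *\<^sub>R e \<in> U" for g :: "'a \<Rightarrow> real" and a e s
    using has_vector_derivative_along_line[OF smooth_on_differentiable[OF that]]
    by (simp add: has_real_derivative_iff_has_vector_derivative)
  define G where "G = (\<lambda>s. f ((p + h *\<^sub>R w) + s *\<^sub>R v) - f (p + s *\<^sub>R v))"
  have "(G has_real_derivative ?g ((p + h *\<^sub>R w) + s *\<^sub>R v) - ?g (p + s *\<^sub>R v)) (at s)"
    if "0 \<le> s" "s \<le> h" for s
    unfolding G_def using sub[of s h] sub[of s 0] that assms(2)
    by (intro DERIV_diff line assms(1)) (auto simp: algebra_simps)
  from MVT2[OF assms(2) this] obtain s where s: "0 < s" "s < h"
    "G h - G 0 = h * (?g ((p + h *\<^sub>R w) + s *\<^sub>R v) - ?g (p + s *\<^sub>R v))" by auto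
  have "((\<lambda>t. ?g ((p + s *\<^sub>R v) + t *\<^sub>R w)) has_real_derivative
      frechet_derivative ?g (at (p + s *\<^sub>R v + t *\<^sub>R w)) w) (at t)" if "0 \<le> t" "t \<le> h" for t
    using sub[of s t] s(1,2) that by (intro line smooth_on_frechet_derivative assms(1)) auto
  from MVT2[OF assms(2) this] obtain t where "0 < t" "t < h"
    "?g (p + s *\<^sub>R v + h *\<^sub>R w) - ?g (p + s *\<^sub>R v)
       = h * frechet_derivative ?g (at (p + s *\<^sub>R v + t *\<^sub>R w)) w" by auto
  with s show ?thesis
    by (intro exI[of _ s] exI[of _ t]) (auto simp: G_def algebra_simps)
qed

text \<open>Both mixed derivatives, each at some point of a small parallelogram, reproduce the same
  second difference; by continuity their values at \<open>p\<close> cannot differ.\<close>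

lemma second_derivative_symmetric_real:
  fixes f :: "'a::real_normed_vector \<Rightarrow> real"
  assumes "open U" "smooth_on U f" "p \<in> U"
  shows "frechet_derivative (\<lambda>x. frechet_derivative f (at x) v) (at p) w
       = frechet_derivative (\<lambda>x. frechet_derivative f (at x) w) (at p) v" (is "?A p = ?B p")
proof (rule ccontr)
  assume ne: "?A p \<noteq> ?B p"
  \<comment> \<open>Half the gap: two errors below \<open>e\<close> cannot bridge it.\<close>
  define e where "e = dist (?A p) (?B p) / 2"
  have e: "e > 0" using ne by (simp add: e_def)
  have cont: "continuous (at p) (\<lambda>q. frechet_derivative (\<lambda>x. frechet_derivative f (at x) a) (at q) b)" for a b
    by (intro differentiable_imp_continuous_within smooth_on_differentiable[OF _ assms(3)]
        smooth_on_frechet_derivative assms(2))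
  have "\<forall>\<^sub>F q in at p. dist (?A q) (?A p) < e" "\<forall>\<^sub>F q in at p. dist (?B q) (?B p) < e"
    using cont[of v w] cont[of w v] e unfolding continuous_at by (auto dest: tendstoD)
  then have "\<forall>\<^sub>F q in nhds p. dist (?A q) (?A p) < e \<and> dist (?B q) (?B p) < e \<and> q \<in> U"
    using e assms(1,3) by (auto simp: eventually_nhds_conv_at intro!: eventually_conj eventually_at_in_open')
  then obtain d where d: "d > 0" "\<And>q. dist q p < d \<Longrightarrow> dist (?A q) (?A p) < e \<and> dist (?B q) (?B p) < e \<and> q \<in> U"
    by (auto simp: eventually_nhds_metric)
  \<comment> \<open>Small enough for the parallelogram with sides \<open>h *\<^sub>R v\<close> and
    \<open>h *\<^sub>R w\<close> to stay in the ball of radius \<open>d\<close>; the summand 1 keeps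
    the denominator positive if both vectors vanish.\<close>
  define h where "h = d / (2 * (norm v + norm w + 1))"
  have nn: "norm v + norm w + 1 > 0" by (smt (verit) norm_ge_zero)
  have h: "h > 0" using d(1) nn by (simp add: h_def)
  have near: "dist (p + s *\<^sub>R v + t *\<^sub>R w) p < d" if "0 \<le> s" "s \<le> h" "0 \<le> t" "t \<le> h" for s t
  proof -
    have "dist (p + s *\<^sub>R v + t *\<^sub>R w) p \<le> s * norm v + t * norm w"
      using that norm_triangle_ineq[of "s *\<^sub>R v" "t *\<^sub>R w"] by (simp add: dist_norm)
    also have "\<dots> \<le> h * norm v + h * norm w"
      using that by (intro add_mono mult_right_mono) auto
    also have "\<dots> \<le> h * (norm v + norm w + 1)" using h by (simp add: algebra_simps)
    also have "\<dots> = d / 2" using nn by (simp add: h_def field_simps)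
    also have "\<dots> < d" using d(1) by simp
    finally show ?thesis .
  qed
  obtain s t where 1: "0 < s" "s < h" "0 < t" "t < h"
    "f (p + h *\<^sub>R v + h *\<^sub>R w) - f (p + h *\<^sub>R v) - f (p + h *\<^sub>R w) + f p = h * (h * ?A (p + s *\<^sub>R v + t *\<^sub>R w))"
    using second_difference_mean_value[OF assms(2) h, of p v w] near d(2) by blast
  have near': "p + s *\<^sub>R w + t *\<^sub>R v \<in> U" if "0 \<le> s" "s \<le> h" "0 \<le> t" "t \<le> h" for s t
    using near[of t s] d(2) that by (metis add.assoc add.commute)
  obtain s' t' where 2: "0 < s'" "s' < h" "0 < t'" "t' < h"
    "f (p + h *\<^sub>R w + h *\<^sub>R v) - f (p + h *\<^sub>R w) - f (p + h *\<^sub>R v) + f p = h * (h * ?B (p + s' *\<^sub>R w + t' *\<^sub>R v))"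
    using second_difference_mean_value[OF assms(2) h, of p w v] near' by blast
  have "h * (h * ?A (p + s *\<^sub>R v + t *\<^sub>R w)) = h * (h * ?B (p + t' *\<^sub>R v + s' *\<^sub>R w))"
    using 1(5) 2(5) by (simp add: algebra_simps)
  then have eq: "?A (p + s *\<^sub>R v + t *\<^sub>R w) = ?B (p + t' *\<^sub>R v + s' *\<^sub>R w)" using h by simp
  have "dist (?A (p + s *\<^sub>R v + t *\<^sub>R w)) (?A p) < e" "dist (?B (p + t' *\<^sub>R v + s' *\<^sub>R w)) (?B p) < e"
    using d(2)[OF near] 1 2 by auto
  then have "dist (?A p) (?B p) < e + e"
    unfolding eq by (simp add: dist_real_def)
  then show False by (simp add: e_def)
qed

text \<open>Reduces to the real case by taking inner products with constant vectors.\<close>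

lemma second_derivative_symmetric:
  fixes f :: "'a::real_normed_vector \<Rightarrow> 'b::real_inner"
  assumes "open U" "smooth_on U f" "p \<in> U"
  shows "frechet_derivative (\<lambda>x. frechet_derivative f (at x) v) (at p) w
       = frechet_derivative (\<lambda>x. frechet_derivative f (at x) w) (at p) v"
proof -
  have inner: "frechet_derivative (\<lambda>x. g x \<bullet> c) (at q) a = frechet_derivative g (at q) a \<bullet> c"
    if "smooth_on U g" "q \<in> U" for g :: "'a \<Rightarrow> 'b" and c q a
    using frechet_derivative_at[OF has_derivative_inner_left[where b = c, OF smooth_on_differentiable[OF that,
      unfolded frechet_derivative_works]]] by (metis)
  have inner2: "frechet_derivative (\<lambda>x. frechet_derivative (\<lambda>x. f x \<bullet> c) (at x) a) (at p) b
      = frechet_derivative (\<lambda>x. frechet_derivative f (at x) a) (at p) b \<bullet> c" for a b c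
  proof -
    have "frechet_derivative (\<lambda>x. frechet_derivative (\<lambda>x. f x \<bullet> c) (at x) a) (at p)
        = frechet_derivative (\<lambda>x. frechet_derivative f (at x) a \<bullet> c) (at p)"
      by (rule frechet_derivative_transform_within_open[OF _ assms(1,3)])
         (use assms inner smooth_on_frechet_derivative smooth_on_inner_const smooth_on_differentiable in \<open>blast+\<close>)
    then show ?thesis
      using inner[OF smooth_on_frechet_derivative[OF assms(2)] assms(3)] by simp
  qed
  have "frechet_derivative (\<lambda>x. frechet_derivative f (at x) v) (at p) w \<bullet> c
       = frechet_derivative (\<lambda>x. frechet_derivative f (at x) w) (at p) v \<bullet> c" for c
    using second_derivative_symmetric_real[OF assms(1) smooth_on_inner_const[OF assms(1,2)] assms(3), of c v w]
    by (simp add: inner2)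
  then show ?thesis by (metis vector_eq_ldot inner_commute)
qed

section \<open>Locality and product rules for derivatives\<close>

lemma smooth_on_subset:
  fixes f :: "'a::real_normed_vector \<Rightarrow> 'b::real_normed_vector"
  assumes "V \<subseteq> U" "smooth_on U f"
  shows "smooth_on V f"
proof -
  have "Ck_on k V g" if "Ck_on k U g" for k and g :: "'a \<Rightarrow> 'b"
    using that assms(1)
  proof (induction k arbitrary: g)
    case 0
    then show ?case by (auto intro: continuous_on_subset)
  next
    case (Suc k)
    then show ?case by (simp only: Ck_on.simps) blast
  qed
  then show ?thesis using assms(2) by (simp add: smooth_on_def)
qed

lemma has_derivative_frechet: "f differentiable (at x) \<Longrightarrow> (f has_derivative frechet_derivative f (at x)) (at x)"
  by (simp add: frechet_derivative_works)

lemma frechet_derivative_inner: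
  fixes f g :: "'a::real_normed_vector \<Rightarrow> 'b::real_inner"
  assumes "f differentiable (at u)" "g differentiable (at u)"
  shows "frechet_derivative (\<lambda>x. f x \<bullet> g x) (at u) v
       = f u \<bullet> frechet_derivative g (at u) v + frechet_derivative f (at u) v \<bullet> g u"
  using frechet_derivative_at[OF has_derivative_inner[OF assms[THEN has_derivative_frechet]]]
  by (metis)

text \<open>\<open>frechet_derivative\<close> is a choice among the derivatives at \<open>u\<close>,
  and \<open>f\<close> and \<open>g\<close> have the same ones; so points where neither is
  differentiable are covered too.\<close>

lemma frechet_derivative_cong_open:
  assumes "open V" "u \<in> V" "\<And>q. q \<in> V \<Longrightarrow> f q = g q"
  shows "frechet_derivative f (at u) = frechet_derivative g (at u)"
proof -
  have "(f has_derivative D) (at u) \<longleftrightarrow> (g has_derivative D) (at u)" for D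
    using has_derivative_transform_within_open[of f D u UNIV V g]
      has_derivative_transform_within_open[of g D u UNIV V f] assms by auto
  then show ?thesis by (simp add: frechet_derivative_def)
qed

lemma differentiable_vec_nth: "g differentiable F \<Longrightarrow> (\<lambda>x. g x $ i) differentiable F"
  unfolding differentiable_def using bounded_linear.has_derivative[OF bounded_linear_vec_nth] by blast

lemma has_real_derivative_quotient_limit:
  fixes g :: "real \<Rightarrow> real"
  assumes "(g has_real_derivative d) (at 0)" "g 0 = 0"
  shows "((\<lambda>t. g t / t) \<longlongrightarrow> d) (at 0)"
  using assms by (simp add: DERIV_def)

section \<open>Determinants\<close>

lemma has_real_derivative_det:
  fixes N :: "real \<Rightarrow> real^'k::finite^'k"
  assumes "\<And>i j. ((\<lambda>t. N t $ i $ j) has_real_derivative N' i j) (at z)"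
  shows "((\<lambda>t. det (N t)) has_real_derivative
     (\<Sum>p | p permutes UNIV. of_int (sign p) * (\<Sum>i\<in>UNIV. N' i (p i) * (\<Prod>j\<in>UNIV-{i}. N z $ j $ p j)))) (at z)"
  unfolding det_def
  by (intro DERIV_sum DERIV_cmult has_field_derivative_prod assms)

lemma differentiable_det:
  fixes A :: "'a::real_normed_vector \<Rightarrow> real^'k::finite^'k"
  assumes "\<And>i j. (\<lambda>x. A x $ i $ j) differentiable (at x)"
  shows "(\<lambda>x. det (A x)) differentiable (at x)"
proof -
  have "(\<lambda>x. \<Prod>i\<in>UNIV. A x $ i $ p i) differentiable (at x)" for p
    using has_derivative_prod[of UNIV "\<lambda>i x. A x $ i $ p i" "\<lambda>i. frechet_derivative (\<lambda>x. A x $ i $ p i) (at x)" x UNIV]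
      assms unfolding differentiable_def[of "\<lambda>x. \<Prod>i\<in>UNIV. A x $ i $ p i"] frechet_derivative_works[symmetric] by blast
  then show ?thesis
    unfolding det_def by (intro differentiable_sum differentiable_mult) simp_all
qed

text \<open>Each term of the differentiated Leibniz expansion differentiates one entry and evaluates
  the others at 0. As row \<open>k\<close> and column \<open>l\<close> vanish there, a term can
  survive only if it differentiates the entry in both, and that derivative is zero.\<close>

lemma DERIV_det_vanishing_cross:
  fixes N :: "real \<Rightarrow> real^'k::finite^'k"
  assumes "\<And>i j. ((\<lambda>t. N t $ i $ j) has_real_derivative N' i j) (at 0)"
    and "\<And>j. N 0 $ k $ j = 0" "\<And>i. N 0 $ i $ l = 0" "N' k l = 0"
  shows "((\<lambda>t. det (N t)) has_real_derivative 0) (at 0)"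
proof -
  have "N' i (p i) * (\<Prod>j\<in>UNIV-{i}. N 0 $ j $ p j) = 0" if p: "p permutes UNIV" for p i
  proof (cases "i = k")
    case False
    then have "(\<Prod>j\<in>UNIV-{i}. N 0 $ j $ p j) = 0"
      using assms(2) by (intro prod_zero) auto
    then show ?thesis by simp
  next
    case True
    show ?thesis
    proof (cases "p i = l")
      case True
      then show ?thesis using \<open>i = k\<close> assms(4) by simp
    next
      case False
      obtain j where j: "p j = l" using p permutes_surj[OF p] by (metis surjD)
      then have "(\<Prod>j\<in>UNIV-{i}. N 0 $ j $ p j) = 0"
        using assms(3) False by (intro prod_zero) auto
      then show ?thesis by simp
    qed
  qed
  then have "(\<Sum>p | p permutes (UNIV :: 'k set). of_int (sign p) *
      (\<Sum>i\<in>UNIV. N' i (p i) * (\<Prod>j\<in>UNIV-{i}. N 0 $ j $ p j))) = 0"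
    by (intro sum.neutral ballI) (metis (no_types, lifting) mem_Collect_eq mult_zero_right sum.neutral)
  then show ?thesis
    using has_real_derivative_det[of N N' 0, OF assms(1)] by metis
qed

text \<open>
  Replacing a column of \<open>M\<close> by \<open>M e\<close> and a row by its combination with weights \<open>w\<close> multiplies the
  determinant by nonzero constants.  At \<open>0\<close> the new row and column vanish, so to first order only
  their common entry \<open>w \<bullet> M e\<close> contributes.
\<close>

lemma det_derivative_kernels:
  fixes M :: "real \<Rightarrow> real^'k::finite^'k" and M' :: "real^'k^'k"
  assumes M: "\<And>i j. ((\<lambda>t. M t $ i $ j) has_real_derivative M' $ i $ j) (at 0)"
    and D: "((\<lambda>t. det (M t)) has_real_derivative D) (at 0)" "D \<noteq> 0"
    and w: "w v* M 0 = 0" "w \<noteq> 0" and e: "M 0 *v e = 0" "e \<noteq> 0"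
  shows "w \<bullet> (M' *v e) \<noteq> 0"
proof
  assume zero: "w \<bullet> (M' *v e) = 0"
  obtain k l where kl: "e $ k \<noteq> 0" "w $ l \<noteq> 0" using e(2) w(2) by (auto simp: vec_eq_iff)
  \<comment> \<open>\<open>cramer_lemma\<close> replaces columns; the transpose in \<open>N\<close>
    makes it available for replacing a row of \<open>A\<close>.\<close>
  define A where "A = (\<lambda>t. (\<chi> i j. if j = k then (M t *v e) $ i else M t $ i $ j) :: real^'k^'k)"
  define N where "N = (\<lambda>t. (\<chi> i j. if j = l then (transpose (A t) *v w) $ i else transpose (A t) $ i $ j) :: real^'k^'k)"
  have detN: "det (N t) = w $ l * (e $ k * det (M t))" for t
    unfolding N_def cramer_lemma det_transpose unfolding A_def cramer_lemma ..
  define A' where "A' = (\<lambda>i j. if j = k then \<Sum>b\<in>UNIV. M' $ i $ b * e $ b else M' $ i $ j)"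
  define N' where "N' = (\<lambda>i j. if j = l then \<Sum>a\<in>UNIV. A' a i * w $ a else A' j i)"
  have dA: "((\<lambda>t. A t $ i $ j) has_real_derivative A' i j) (at 0)" for i j
    by (auto simp: A_def A'_def matrix_vector_mult_def intro!: DERIV_sum DERIV_cmult_right M)
  have dN: "((\<lambda>t. N t $ i $ j) has_real_derivative N' i j) (at 0)" for i j
    by (auto simp: N_def N'_def matrix_vector_mult_def transpose_def intro!: DERIV_sum DERIV_cmult_right dA)
  have A0: "A 0 $ i $ k = 0" for i using e(1) by (simp add: A_def)
  have "((\<lambda>t. det (N t)) has_real_derivative 0) (at 0)"
  proof (rule DERIV_det_vanishing_cross[of N N' k l])
    show "N 0 $ k $ j = 0" for j
      by (simp add: N_def matrix_vector_mult_def transpose_def A0)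
    show "N 0 $ i $ l = 0" for i
    proof (cases "i = k")
      case True
      then show ?thesis by (simp add: N_def matrix_vector_mult_def transpose_def A0)
    next
      case False
      then have "N 0 $ i $ l = (transpose (M 0) *v w) $ i"
        by (simp add: N_def A_def matrix_vector_mult_def transpose_def)
      then show ?thesis using w by simp
    qed
    show "N' k l = 0"
      using zero by (simp add: N'_def A'_def inner_vec_def matrix_vector_mult_def mult.commute)
  qed (rule dN)
  moreover have "((\<lambda>t. det (N t)) has_real_derivative w $ l * (e $ k * D)) (at 0)"
    unfolding detN by (intro DERIV_cmult D)
  ultimately show False using DERIV_unique kl D(2) by fastforce
qed

section \<open>The Gauss equation\<close>

abbreviation (input) second_derivative where
  "second_derivative F u x y \<equiv> frechet_derivative (\<lambda>q. frechet_derivative F (at q) x) (at u) y"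

lemma second_derivative_partials:
  fixes F :: "real^'m::finite \<Rightarrow> 'b::real_inner"
  assumes "open V" "smooth_on V F" "u \<in> V"
  shows "second_derivative F u x y = (\<Sum>i\<in>UNIV. \<Sum>j\<in>UNIV. (x $ i * y $ j) *\<^sub>R partial_deriv i (partial_deriv j F) u)"
proof -
  have d: "second_derivative F u a b = (\<Sum>i\<in>UNIV. b $ i *\<^sub>R second_derivative F u a (axis i 1))" for a b
    by (subst frechet_derivative_partials[OF smooth_on_differentiable[OF smooth_on_frechet_derivative[OF assms(2)] assms(3)]])
       (simp add: partial_deriv_def)
  have "second_derivative F u x y = (\<Sum>j\<in>UNIV. y $ j *\<^sub>R second_derivative F u (axis j 1) x)"
    by (subst d) (simp add: second_derivative_symmetric[OF assms, of x])
  also have "\<dots> = (\<Sum>j\<in>UNIV. y $ j *\<^sub>R (\<Sum>i\<in>UNIV. x $ i *\<^sub>R second_derivative F u (axis j 1) (axis i 1)))"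
    by (subst d) simp
  also have "\<dots> = (\<Sum>j\<in>UNIV. \<Sum>i\<in>UNIV. (x $ i * y $ j) *\<^sub>R second_derivative F u (axis j 1) (axis i 1))"
    by (simp add: scaleR_sum_right mult.commute)
  finally show ?thesis by (subst sum.swap) (simp add: partial_deriv_def[abs_def])
qed

lemma metric_at_induced_metric:
  fixes F :: "real^'m::finite \<Rightarrow> 'b::real_inner"
  assumes "F differentiable (at u)"
  shows "metric_at (induced_metric F) u x y = frechet_derivative F (at u) x \<bullet> frechet_derivative F (at u) y"
  unfolding metric_at_def frechet_derivative_partials[OF assms] inner_sum_left inner_sum_right
  by (subst sum.swap) (simp add: inner_vec_def matrix_vector_mult_def induced_metric_def sum_distrib_left mult_ac)

text \<open>A kernel vector \<open>x\<close> of the Gram matrix would have \<open>dF x\<close> of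
  length zero.\<close>

lemma det_induced_metric_nonzero:
  fixes F :: "real^'m::finite \<Rightarrow> 'b::real_inner"
  assumes "immersion_at F u"
  shows "det (induced_metric F u) \<noteq> 0"
proof
  assume "det (induced_metric F u) = 0"
  then obtain x where x: "x \<noteq> 0" "induced_metric F u *v x = 0"
    by (metis invertible_det_nz invertible_left_inverse matrix_left_invertible_ker)
  have "metric_at (induced_metric F) u x x = 0" using x by (simp add: metric_at_def)
  then have "frechet_derivative F (at u) x = 0"
    using metric_at_induced_metric assms by (metis immersion_at_def inner_eq_zero_iff)
  moreover have "frechet_derivative F (at u) 0 = 0"
    using assms by (simp add: immersion_at_def linear_0 linear_frechet_derivative)
  ultimately show False using x(1) assms unfolding immersion_at_def by (metis injD)
qed

text \<open>
  \<open>\<beta>\<close> below is the \<open>w\<close>-component of the second fundamental form; the last premise says that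
  the normal part of the second derivatives lies in the line spanned by \<open>w\<close>.
\<close>

proposition gauss_equation:
  fixes F :: "real^'m::finite \<Rightarrow> 'b::real_inner"
  assumes V: "open V" and F: "smooth_on V F" and imm: "\<And>q. q \<in> V \<Longrightarrow> immersion_at F q"
    and u: "u \<in> V" and w: "norm w = 1" "\<And>x. frechet_derivative F (at u) x \<bullet> w = 0"
    and normal: "\<And>z x y. (\<And>v. z \<bullet> frechet_derivative F (at u) v = 0) \<Longrightarrow> z \<bullet> w = 0 \<Longrightarrow>
        z \<bullet> second_derivative F u x y = 0"
  defines "\<beta> \<equiv> \<lambda>x y. second_derivative F u x y \<bullet> w"
  shows "metric_at (induced_metric F) u (curvature_operator (induced_metric F) u x y y) x
       = \<beta> x x * \<beta> y y - (\<beta> x y)\<^sup>2"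
proof -
  define g where "g = induced_metric F"
  \<comment> \<open>\<open>P\<close>, \<open>S\<close>, \<open>T\<close> are the first, second and
    third partial derivatives of \<open>F\<close>; \<open>N\<close> will turn out to be the part of
    \<open>S\<close> normal to the image of \<open>dF\<close>.\<close>
  define P where "P = (\<lambda>k. partial_deriv k F)"
  define S where "S = (\<lambda>j k. partial_deriv j (P k))"
  define T where "T = (\<lambda>i j k. partial_deriv i (S j k))"
  define \<Gamma> where "\<Gamma> = (\<lambda>l i j. christoffel g l i j)"
  define N where "N = (\<lambda>j k q. S j k q - (\<Sum>l\<in>UNIV. \<Gamma> l j k q *\<^sub>R P l q))"
  have P: "smooth_on V (P k)" for k
    unfolding P_def partial_deriv_def[abs_def] by (intro smooth_on_frechet_derivative F)
  have S: "smooth_on V (S j k)" for j k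
    unfolding S_def using smooth_on_frechet_derivative[OF P] by (simp add: partial_deriv_def[abs_def])
  note dP = smooth_on_differentiable[OF P] and dS = smooth_on_differentiable[OF S]
  have Ssym: "S j k q = S k j q" if "q \<in> V" for j k q
    unfolding S_def P_def partial_deriv_def[abs_def]
    by (rule second_derivative_symmetric[OF V F that])
  have Tsym: "T i j k u = T j i k u" for i j k
    unfolding T_def S_def
    using second_derivative_symmetric[OF V P u] by (simp add: partial_deriv_def[abs_def])
  have g: "g q $ i $ j = P i q \<bullet> P j q" for q i j
    by (simp add: g_def induced_metric_def P_def)
  have dg: "partial_deriv k (\<lambda>q. g q $ i $ j) q = S k i q \<bullet> P j q + P i q \<bullet> S k j q" if "q \<in> V" for i j k q
    unfolding g using frechet_derivative_inner[OF dP[OF that] dP[OF that]]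
    by (simp add: partial_deriv_def S_def)
  have detg: "det (g q) \<noteq> 0" if "q \<in> V" for q
    using det_induced_metric_nonzero[OF imm[OF that]] by (simp add: g_def)
  have \<Gamma>: "\<Gamma> l i j q = (matrix_inv (g q) *v (\<chi> s. S i j q \<bullet> P s q)) $ l" if "q \<in> V" for l i j q
  proof -
    \<comment> \<open>Symmetry of \<open>S\<close> collapses the Christoffel combination to one
      term, so the \<Gamma> are the coefficients of the tangential part of
      \<open>S i j\<close>.\<close>
    have lowered: "S i j q \<bullet> P s q + P j q \<bullet> S i s q + (S j i q \<bullet> P s q + P i q \<bullet> S j s q)
        - (S s i q \<bullet> P j q + P i q \<bullet> S s j q) = 2 * (S i j q \<bullet> P s q)" for s
      unfolding Ssym[OF that, of j i] Ssym[OF that, of s i] Ssym[OF that, of s j] by (simp add: inner_commute)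
    then show ?thesis
      unfolding \<Gamma>_def christoffel_def dg[OF that] matrix_vector_mult_def lowered
      by (simp add: sum_distrib_left)
  qed
  have g\<Gamma>v: "g q *v (\<chi> l. \<Gamma> l i j q) = (\<chi> s. S i j q \<bullet> P s q)" if "q \<in> V" for i j q
  proof -
    have "g q ** matrix_inv (g q) = mat 1"
      using detg[OF that] someI_ex[of "\<lambda>B. g q ** B = mat 1 \<and> B ** g q = mat 1"]
      unfolding matrix_inv_def invertible_det_nz[symmetric] invertible_def by blast
    then show ?thesis
      by (simp add: \<Gamma>[OF that] vec_lambda_eta matrix_vector_mul_assoc)
  qed
  have g\<Gamma>: "(\<Sum>l\<in>UNIV. (P m q \<bullet> P l q) * \<Gamma> l i j q) = S i j q \<bullet> P m q" if "q \<in> V" for m i j q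
    using arg_cong[OF g\<Gamma>v[OF that, of i j], of "\<lambda>v. v $ m"] by (simp add: matrix_vector_mult_def g)
  \<comment> \<open>Cramer's rule expresses \<Gamma> as a quotient of determinants with
    differentiable entries, which avoids differentiating \<open>matrix_inv\<close>.\<close>
  have d\<Gamma>: "\<Gamma> l i j differentiable (at u)" for l i j
  proof -
    have eq: "\<Gamma> l i j q = det (\<chi> a b. if b = l then (\<chi> s. S i j q \<bullet> P s q) $ a else g q $ a $ b) / det (g q)" if "q \<in> V" for q
      using arg_cong[OF iffD1[OF cramer[OF detg[OF that]] g\<Gamma>v[OF that, of i j]], of "\<lambda>v. v $ l"] by simp
    have "(\<lambda>q. det (\<chi> a b. if b = l then (\<chi> s. S i j q \<bullet> P s q) $ a else g q $ a $ b) / det (g q)) differentiable (at u)"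
    proof (intro differentiable_divide differentiable_det)
      show "(\<lambda>q. (\<chi> a b. if b = l then (\<chi> s. S i j q \<bullet> P s q) $ a else g q $ a $ b) $ a $ b) differentiable (at u)" for a b
        using u dP dS by (cases "b = l") (auto simp: g)
    qed (use u detg dP in \<open>auto simp: g intro!: differentiable_det\<close>)
    then show ?thesis
      using eq has_derivative_transform_within_open[OF _ V u, of _ _ UNIV "\<Gamma> l i j"] unfolding differentiable_def by simp blast
  qed
  have NP: "N j k q \<bullet> P m q = 0" if "q \<in> V" for j k m q
    using g\<Gamma>[OF that, of m j k]
    unfolding N_def inner_diff_left inner_sum_left inner_scaleR_left
    by (simp add: inner_commute[of _ "P m q"] mult.commute)
  have dN: "(N j k has_derivative (\<lambda>v. frechet_derivative (S j k) (at u) v -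
      (\<Sum>l\<in>UNIV. \<Gamma> l j k u *\<^sub>R frechet_derivative (P l) (at u) v + frechet_derivative (\<Gamma> l j k) (at u) v *\<^sub>R P l u))) (at u)" for j k
    unfolding N_def using u dP dS d\<Gamma>
    by (intro has_derivative_diff has_derivative_sum has_derivative_scaleR has_derivative_frechet) auto
  have pN: "partial_deriv i (N j k) u = T i j k u - (\<Sum>l\<in>UNIV. \<Gamma> l j k u *\<^sub>R S i l u + partial_deriv i (\<Gamma> l j k) u *\<^sub>R P l u)" for i j k
    using fun_cong[OF frechet_derivative_at[OF dN, of j k], of "axis i 1"] by (simp add: partial_deriv_def T_def S_def)
  \<comment> \<open>The Weingarten relation: differentiate the orthogonality \<open>NP\<close>; only
    the normal part \<open>N\<close> of \<open>S\<close> pairs with the normal vector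
    \<open>N j k u\<close>.\<close>
  have dNP: "partial_deriv i (N j k) u \<bullet> P m u = - (N j k u \<bullet> N i m u)" for i j k m
  proof -
    have "partial_deriv i (\<lambda>q. N j k q \<bullet> P m q) u = partial_deriv i (\<lambda>q. 0) u"
      unfolding partial_deriv_def using frechet_derivative_cong_open[OF V u, of "\<lambda>q. N j k q \<bullet> P m q" "\<lambda>q. 0"] NP by simp
    then have "N j k u \<bullet> S i m u + partial_deriv i (N j k) u \<bullet> P m u = 0"
      using frechet_derivative_inner[OF _ dP[OF u], of "N j k" m "axis i 1"] differentiableI[OF dN[of j k]]
      by (simp add: partial_deriv_def S_def)
    moreover have "N j k u \<bullet> S i m u = N j k u \<bullet> N i m u"
      using NP[OF u] by (subst (2) N_def) (simp add: inner_diff_right inner_sum_right)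
    ultimately show ?thesis by simp
  qed
  \<comment> \<open>Half of the curvature expression with its upper index lowered. The term with
    \<open>T\<close> is symmetric in \<open>i\<close> and \<open>j\<close> and cancels in
    \<open>riem\<close>, leaving products of normal parts.\<close>
  have key: "(\<Sum>l\<in>UNIV. (P m u \<bullet> P l u) * (partial_deriv i (\<Gamma> l j k) u + (\<Sum>s\<in>UNIV. \<Gamma> l i s u * \<Gamma> s j k u)))
      = T i j k u \<bullet> P m u + N j k u \<bullet> N i m u" for i j k m
  proof -
    have "(\<Sum>l\<in>UNIV. (P m u \<bullet> P l u) * (\<Sum>s\<in>UNIV. \<Gamma> l i s u * \<Gamma> s j k u))
        = (\<Sum>s\<in>UNIV. \<Gamma> s j k u * (\<Sum>l\<in>UNIV. (P m u \<bullet> P l u) * \<Gamma> l i s u))"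
      unfolding sum_distrib_left by (subst sum.swap) (simp add: mult_ac)
    also have "\<dots> = (\<Sum>s\<in>UNIV. \<Gamma> s j k u * (S i s u \<bullet> P m u))"
      by (simp add: g\<Gamma>[OF u])
    finally have "(\<Sum>l\<in>UNIV. (P m u \<bullet> P l u) * (partial_deriv i (\<Gamma> l j k) u + (\<Sum>s\<in>UNIV. \<Gamma> l i s u * \<Gamma> s j k u)))
      = (\<Sum>l\<in>UNIV. (P m u \<bullet> P l u) * partial_deriv i (\<Gamma> l j k) u) + (\<Sum>s\<in>UNIV. \<Gamma> s j k u * (S i s u \<bullet> P m u))"
      by (simp add: distrib_left sum.distrib)
    also have "\<dots> = (T i j k u - partial_deriv i (N j k) u) \<bullet> P m u"
      unfolding pN diff_diff_eq2 add_diff_cancel_left' inner_sum_left inner_add_left inner_scaleR_left inner_diff_left sum.distrib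
      by (simp add: inner_commute[of "P m u"] mult.commute)
    finally show ?thesis by (simp add: inner_diff_left dNP)
  qed
  have Nw: "N j k u = (S j k u \<bullet> w) *\<^sub>R w" for j k
  proof -
    have Pw: "P l u \<bullet> w = 0" for l using w(2) by (simp add: P_def partial_deriv_def)
    have ww: "w \<bullet> w = 1" using w(1) by (simp add: dot_square_norm)
    have SN: "S j k u \<bullet> w = N j k u \<bullet> w"
      by (simp add: N_def inner_diff_left inner_sum_left Pw)
    \<comment> \<open>The part of \<open>N j k u\<close> orthogonal to \<open>w\<close>. It is
      normal to the image of \<open>dF\<close>, so the premise \<open>normal\<close> makes it
      orthogonal to \<open>S\<close>, then to \<open>N\<close>, and finally to itself.\<close>
    define z where "z = N j k u - (N j k u \<bullet> w) *\<^sub>R w"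
    have zP: "z \<bullet> P l u = 0" for l
      using NP[OF u] Pw by (simp add: z_def inner_diff_left inner_commute[of w])
    have zw: "z \<bullet> w = 0" by (simp add: z_def inner_diff_left ww)
    have zd: "z \<bullet> frechet_derivative F (at u) v = 0" for v
      using zP unfolding frechet_derivative_partials[OF smooth_on_differentiable[OF F u]] inner_sum_right P_def by simp
    have "z \<bullet> S j k u = 0"
      using normal[OF zd zw, of "axis k 1" "axis j 1"] by (simp add: S_def P_def partial_deriv_def[abs_def])
    then have "z \<bullet> N j k u = 0"
      by (simp add: N_def inner_diff_right inner_sum_right zP)
    then have "z \<bullet> z = 0"
      by (subst (2) z_def) (simp add: inner_diff_right zw)
    then show ?thesis by (simp add: z_def SN)
  qed
  define b where "b = (\<lambda>j k. S j k u \<bullet> w)"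
  have NN: "N j k u \<bullet> N i m u = b j k * b i m" for i j k m
    using w(1) by (simp add: Nw b_def dot_square_norm)
  have bsym: "b j k = b k j" for j k by (simp add: b_def Ssym[OF u, of j k])
  have riem: "(\<Sum>l\<in>UNIV. (P m u \<bullet> P l u) * riemann g l i j k u) = b j k * b i m - b i k * b j m" for i j k m
  proof -
    have "(\<Sum>l\<in>UNIV. (P m u \<bullet> P l u) * riemann g l i j k u)
      = (\<Sum>l\<in>UNIV. (P m u \<bullet> P l u) * (partial_deriv i (\<Gamma> l j k) u + (\<Sum>s\<in>UNIV. \<Gamma> l i s u * \<Gamma> s j k u)))
      - (\<Sum>l\<in>UNIV. (P m u \<bullet> P l u) * (partial_deriv j (\<Gamma> l i k) u + (\<Sum>s\<in>UNIV. \<Gamma> l j s u * \<Gamma> s i k u)))"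
      unfolding sum_subtractf[symmetric] right_diff_distrib[symmetric]
      by (simp add: riemann_def \<Gamma>_def sum_subtractf algebra_simps)
    then show ?thesis unfolding key using Tsym[of i j k] by (simp add: NN)
  qed
  have \<beta>: "\<beta> a c = (\<Sum>i\<in>UNIV. \<Sum>j\<in>UNIV. a $ i * c $ j * b i j)" for a c
    unfolding \<beta>_def second_derivative_partials[OF V F u] inner_sum_left b_def S_def P_def by simp
  have "metric_at g u (curvature_operator g u x y y) x
      = (\<Sum>l\<in>UNIV. \<Sum>m\<in>UNIV. (\<Sum>i\<in>UNIV. \<Sum>j\<in>UNIV. \<Sum>k\<in>UNIV. riemann g l i j k u * x $ i * y $ j * y $ k) * ((P l u \<bullet> P m u) * x $ m))"
    by (simp add: metric_at_def inner_vec_def curvature_operator_def matrix_vector_mult_def g sum_distrib_left)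
  \<comment> \<open>The sum over \<open>l\<close> moves innermost so that \<open>riem\<close>
    applies.\<close>
  also have "\<dots> = (\<Sum>m\<in>UNIV. \<Sum>i\<in>UNIV. \<Sum>j\<in>UNIV. \<Sum>k\<in>UNIV. \<Sum>l\<in>UNIV. (P l u \<bullet> P m u) * riemann g l i j k u * (x $ i * y $ j * y $ k * x $ m))"
    unfolding sum_distrib_right
    by (rule trans[OF sum.swap sum.cong[OF refl]])+ (simp add: mult_ac)
  also have "\<dots> = (\<Sum>m\<in>UNIV. \<Sum>i\<in>UNIV. \<Sum>j\<in>UNIV. \<Sum>k\<in>UNIV. (b j k * b i m - b i k * b j m) * (x $ i * y $ j * y $ k * x $ m))"
    unfolding sum_distrib_right[symmetric] riem[symmetric] by (simp add: inner_commute)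
  also have "\<dots> = (\<Sum>m\<in>UNIV. \<Sum>i\<in>UNIV. (x $ i * x $ m * b i m) * \<beta> y y - (\<Sum>j\<in>UNIV. y $ j * x $ m * b j m) * (\<Sum>k\<in>UNIV. x $ i * y $ k * b i k))"
    unfolding \<beta> sum_product unfolding sum_distrib_left sum_subtractf[symmetric] by (simp add: algebra_simps)
  also have "\<dots> = \<beta> x x * \<beta> y y - \<beta> x y * \<beta> x y"
  proof -
    have 1: "(\<Sum>m\<in>UNIV. \<Sum>i\<in>UNIV. x $ i * x $ m * b i m) = \<beta> x x"
      unfolding \<beta> by (rule sum.swap)
    have 2: "(\<Sum>m\<in>UNIV. \<Sum>j\<in>UNIV. y $ j * x $ m * b j m) = \<beta> x y"
      unfolding \<beta> by (simp add: bsym mult_ac)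
    have "(\<Sum>m\<in>UNIV. \<Sum>i\<in>UNIV. (\<Sum>j\<in>UNIV. y $ j * x $ m * b j m) * (\<Sum>k\<in>UNIV. x $ i * y $ k * b i k)) = \<beta> x y * \<beta> x y"
      unfolding sum_product[symmetric] 2 by (simp add: \<beta>)
    then show ?thesis
      by (simp add: sum_subtractf sum_distrib_right[symmetric] 1)
  qed
  finally show ?thesis by (simp add: g_def power2_eq_square)
qed

section \<open>Planes\<close>

text \<open>In this form, as a condition on coefficients of the pair, independence is easily carried
  through linear maps.\<close>

lemma spans_plane_iff: "spans_plane x y \<longleftrightarrow> (\<forall>a b. a *\<^sub>R x + b *\<^sub>R y = 0 \<longrightarrow> a = 0 \<and> b = 0)"
proof
  assume xy: "spans_plane x y"
  show "\<forall>a b. a *\<^sub>R x + b *\<^sub>R y = 0 \<longrightarrow> a = 0 \<and> b = 0"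
  proof (intro allI impI)
    fix a b assume "a *\<^sub>R x + b *\<^sub>R y = 0"
    then have "(\<Sum>v\<in>{x, y}. (if v = x then a else b) *\<^sub>R v) = 0"
      using xy by (auto simp: spans_plane_def)
    then have "(if v = x then a else b) = 0" if "v \<in> {x, y}" for v
      using independentD[of "{x, y}" "{x, y}" "\<lambda>v. if v = x then a else b" v] xy that
      by (auto simp: spans_plane_def)
    from this[of x] this[of y] xy show "a = 0 \<and> b = 0"
      by (auto simp: spans_plane_def)
  qed
next
  assume *: "\<forall>a b. a *\<^sub>R x + b *\<^sub>R y = 0 \<longrightarrow> a = 0 \<and> b = 0"
  have ne: "x \<noteq> y" using *[rule_format, of 1 "-1"] by auto
  have "independent {x, y}"
  proof (rule independent_if_scalars_zero)
    fix c z assume "(\<Sum>v\<in>{x, y}. c v *\<^sub>R v) = 0" "z \<in> {x, y}"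
    then show "c z = 0" using ne * by auto
  qed simp
  with ne show "spans_plane x y" by (simp add: spans_plane_def)
qed

lemma spans_plane_linear_image:
  assumes "linear L" "inj L" "spans_plane x y"
  shows "spans_plane (L x) (L y)"
  unfolding spans_plane_iff
proof (intro allI impI)
  fix a b assume "a *\<^sub>R L x + b *\<^sub>R L y = 0"
  then have "L (a *\<^sub>R x + b *\<^sub>R y) = L 0"
    using assms(1) by (simp add: linear_add linear_scale linear_0)
  then show "a = 0 \<and> b = 0" using assms(2,3) unfolding spans_plane_iff by (metis injD)
qed

text \<open>The vector \<open>z\<close> below is \<open>x \<bullet> x\<close> times the component of
  \<open>y\<close> orthogonal to \<open>x\<close>; its squared length is
  \<open>x \<bullet> x\<close> times the Gram determinant.\<close>

lemma gram_pos:
  fixes x y :: "'a::real_inner"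
  assumes "spans_plane x y"
  shows "(x \<bullet> x) * (y \<bullet> y) - (x \<bullet> y)\<^sup>2 > 0"
proof -
  have xy: "a = 0 \<and> b = 0" if "a *\<^sub>R x + b *\<^sub>R y = 0" for a b
    using assms that by (simp add: spans_plane_iff)
  define z where "z = (- (x \<bullet> y)) *\<^sub>R x + (x \<bullet> x) *\<^sub>R y"
  have x: "x \<bullet> x > 0" using xy[of 1 0] by auto
  then have "z \<bullet> z > 0" using xy[of "- (x \<bullet> y)" "x \<bullet> x"] by (auto simp: z_def)
  moreover have "z \<bullet> z = (x \<bullet> x) * ((x \<bullet> x) * (y \<bullet> y) - (x \<bullet> y)\<^sup>2)"
    by (simp add: z_def inner_add_left inner_add_right inner_commute[of y x] algebra_simps power2_eq_square)
  ultimately show ?thesis using x by (simp add: zero_less_mult_iff)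
qed

lemma not_spans_plane_imp_multiple:
  assumes "e \<noteq> 0" "\<not> spans_plane x e"
  shows "\<exists>r. x = r *\<^sub>R e"
proof -
  obtain a b where ab: "a *\<^sub>R x + b *\<^sub>R e = 0" "a \<noteq> 0 \<or> b \<noteq> 0"
    using assms(2) by (auto simp: spans_plane_iff)
  then have "a \<noteq> 0" using assms(1) by auto
  then have "x = (1 / a) *\<^sub>R (a *\<^sub>R x)" by simp
  also have "a *\<^sub>R x = - (b *\<^sub>R e)" using ab(1) by (simp add: eq_neg_iff_add_eq_0)
  finally show ?thesis by (metis scaleR_minus_left scaleR_scaleR)
qed

section \<open>Fronts\<close>

lemma sum_option:
  fixes g :: "'n::finite option \<Rightarrow> 'a::comm_monoid_add"
  shows "(\<Sum>b\<in>UNIV. g b) = g None + (\<Sum>i\<in>UNIV. g (Some i))"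
  by (simp add: UNIV_option_conv sum.reindex)

locale front =
  fixes U :: "(real^'n::finite) set" and f \<nu> :: "real^'n \<Rightarrow> real^('n option)"
  assumes open_U: "open U" and front: "front_with U f \<nu>"
begin

abbreviation "df u \<equiv> frechet_derivative f (at u)"
abbreviation "d\<nu> u \<equiv> frechet_derivative \<nu> (at u)"
abbreviation "h \<equiv> second_fundamental_form f \<nu>"
abbreviation "\<rho> \<equiv> signed_density f \<nu>"
abbreviation "d\<rho> u \<equiv> frechet_derivative \<rho> (at u)"

text \<open>The matrix under the determinant in \<open>signed_density\<close>, named so that its
  kernels and entries can be addressed.\<close>

definition J :: "real^'n \<Rightarrow> real^('n option)^('n option)" where
  "J u = (\<chi> a b. (case b of Some i \<Rightarrow> partial_deriv i f u | None \<Rightarrow> \<nu> u) $ a)"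

lemma smooth_f: "smooth_on U f" and smooth_\<nu>: "smooth_on U \<nu>"
  and unit: "u \<in> U \<Longrightarrow> norm (\<nu> u) = 1"
  and df_\<nu>: "u \<in> U \<Longrightarrow> df u x \<bullet> \<nu> u = 0"
  and lift_immersion: "u \<in> U \<Longrightarrow> immersion_at (\<lambda>w. (f w, \<nu> w)) u"
  using front by (auto simp: front_with_def)

lemmas diff_f = smooth_on_differentiable[OF smooth_f]
lemmas diff_\<nu> = smooth_on_differentiable[OF smooth_\<nu>]
lemmas diff_df = smooth_on_differentiable[OF smooth_on_frechet_derivative[OF smooth_f]]
lemmas diff_d\<nu> = smooth_on_differentiable[OF smooth_on_frechet_derivative[OF smooth_\<nu>]]
lemmas linear_df = linear_frechet_derivative[OF diff_f]
lemmas linear_d\<nu> = linear_frechet_derivative[OF diff_\<nu>]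
lemmas d2f_sym = second_derivative_symmetric[OF open_U smooth_f]
lemmas d2\<nu>_sym = second_derivative_symmetric[OF open_U smooth_\<nu>]

text \<open>Linearity in the direction of differentiation, carried to the other slot by
  symmetry.\<close>

lemma linear_d2f: "u \<in> U \<Longrightarrow> linear (\<lambda>e. second_derivative f u e v)"
  using linear_frechet_derivative[OF diff_df] d2f_sym[of u _ v] by simp

section \<open>Identities obtained by differentiating the front conditions\<close>

lemma frechet_derivative_zero_on:
  assumes "open V" "u \<in> V" "\<And>q. q \<in> V \<Longrightarrow> g q = 0"
  shows "frechet_derivative g (at u) y = 0"
  using frechet_derivative_cong_open[OF assms(1,2), of g "\<lambda>_. 0"] assms(3) by simp

lemma d\<nu>_\<nu>: assumes "u \<in> U" shows "d\<nu> u x \<bullet> \<nu> u = 0"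
proof -
  have "frechet_derivative (\<lambda>q. \<nu> q \<bullet> \<nu> q - 1) (at u) x = 0"
    by (rule frechet_derivative_zero_on[OF open_U assms]) (simp add: dot_square_norm unit)
  moreover have "((\<lambda>q. \<nu> q \<bullet> \<nu> q - 1) has_derivative (\<lambda>x. \<nu> u \<bullet> d\<nu> u x + d\<nu> u x \<bullet> \<nu> u)) (at u)"
    using diff_\<nu>[OF assms] by (auto intro!: derivative_eq_intros has_derivative_frechet)
  ultimately show ?thesis
    using fun_cong[OF frechet_derivative_at, of "\<lambda>q. \<nu> q \<bullet> \<nu> q - 1" _ u x] by (simp add: inner_commute)
qed

text \<open>Differentiates the orthogonality of \<open>df x\<close> and \<nu>. Symmetry of
  \<open>h\<close> follows from it.\<close>

lemma h_eq: assumes "u \<in> U" shows "h u x y = second_derivative f u x y \<bullet> \<nu> u"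
proof -
  have "frechet_derivative (\<lambda>q. df q x \<bullet> \<nu> q) (at u) y = 0"
    by (rule frechet_derivative_zero_on[OF open_U assms]) (simp add: df_\<nu>)
  then show ?thesis
    using frechet_derivative_inner[OF diff_df[OF assms] diff_\<nu>[OF assms]]
    by (simp add: second_fundamental_form_def)
qed

lemma h_sym: "u \<in> U \<Longrightarrow> h u x y = h u y x"
  by (simp add: h_eq d2f_sym)

lemma h_null: assumes "u \<in> U" "df u e = 0" shows "h u e y = 0" "h u y e = 0"
  using assms h_sym[of u y e] by (auto simp: second_fundamental_form_def)

text \<open>Polarization.\<close>

lemma h_zero_of_diagonal:
  assumes "u \<in> U" "\<And>x. h u x x = 0"
  shows "h u x y = 0"
proof -
  have "h u (x + y) (x + y) = h u x x + h u y y + 2 * h u x y"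
    using h_sym[OF assms(1), of x y]
    by (simp add: second_fundamental_form_def linear_add[OF linear_df] linear_add[OF linear_d\<nu>] assms(1)
        inner_add_left inner_add_right)
  then show ?thesis using assms(2) by simp
qed

section \<open>The signed density and the kernels of its matrix\<close>

lemma J_mult: "J u *v (\<chi> b. case b of Some i \<Rightarrow> x $ i | None \<Rightarrow> s) = (\<Sum>i\<in>UNIV. x $ i *\<^sub>R partial_deriv i f u) + s *\<^sub>R \<nu> u"
  by (simp add: vec_eq_iff J_def matrix_vector_mult_def sum_option mult.commute)

lemma mult_J: "(z v* J u) $ b = (case b of Some i \<Rightarrow> z \<bullet> partial_deriv i f u | None \<Rightarrow> z \<bullet> \<nu> u)"
  by (cases b) (simp_all add: J_def vector_matrix_mult_def inner_vec_def mult.commute)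

lemma kernel_J:
  assumes "\<And>x. z \<bullet> df u x = 0" "z \<bullet> \<nu> u = 0"
  shows "z v* J u = 0"
  using assms by (auto simp: vec_eq_iff mult_J partial_deriv_def split: option.split)

lemma signed_density_J: "\<rho> u = det (J u)"
  by (simp add: signed_density_def J_def)

lemma diff_J: "u \<in> U \<Longrightarrow> (\<lambda>q. J q $ a $ b) differentiable (at u)"
  by (cases b) (auto simp: J_def partial_deriv_def[abs_def] intro!: diff_df diff_\<nu> 
     differentiable_vec_nth)

lemma diff_\<rho>: "u \<in> U \<Longrightarrow> \<rho> differentiable (at u)"
  unfolding signed_density_J[abs_def] by (intro differentiable_det diff_J)

lemma linear_d\<rho>: "u \<in> U \<Longrightarrow> linear (d\<rho> u)"
  by (intro linear_frechet_derivative diff_\<rho>)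

text \<open>A kernel vector of \<open>df\<close>, extended by 0 at the index \<open>None\<close>, is
  a kernel vector of \<open>J\<close>.\<close>

lemma density_nonzero_imp_immersion:
  assumes "u \<in> U" "\<rho> u \<noteq> 0"
  shows "immersion_at f u"
proof -
  have "x = 0" if "df u x = 0" for x
  proof -
    have "J u *v (\<chi> b. case b of Some i \<Rightarrow> x $ i | None \<Rightarrow> 0) = 0"
      using that unfolding J_mult by (simp add: frechet_derivative_partials[OF diff_f[OF assms(1)]])
    then have "(\<chi> b. case b of Some i \<Rightarrow> x $ i | None \<Rightarrow> 0) = 0"
      using assms(2) unfolding signed_density_J
      by (metis invertible_det_nz invertible_left_inverse matrix_left_invertible_ker)
    then have "(\<chi> b. case b of Some i \<Rightarrow> x $ i | None \<Rightarrow> 0) $ Some i = 0" for i by simp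
    then show ?thesis by (simp add: vec_eq_iff)
  qed
  then show ?thesis
    unfolding immersion_at_def using linear_injective_0[OF linear_df[OF assms(1)]] diff_f[OF assms(1)] by blast
qed

lemma singular_density: "u \<in> singular_set U f \<Longrightarrow> \<rho> u = 0"
  using density_nonzero_imp_immersion by (auto simp: singular_set_def)

text \<open>Such a \<open>z\<close> is a left kernel vector of the invertible matrix
  \<open>J u\<close>.\<close>

lemma normal_trivial:
  assumes "\<rho> u \<noteq> 0" "\<And>x. z \<bullet> df u x = 0" "z \<bullet> \<nu> u = 0"
  shows "z = 0"
proof -
  have "det (transpose (J u)) \<noteq> 0" "transpose (J u) *v z = 0"
    using assms(1) kernel_J[OF assms(2,3)] by (simp_all add: signed_density_J)
  then show ?thesis
    by (metis invertible_det_nz invertible_left_inverse matrix_left_invertible_ker)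
qed

text \<open>Applies \<open>gauss_equation\<close> on the set where \<rho> is nonzero, which is open
  by continuity. There the premise on normal vectors is trivial by
  \<open>normal_trivial\<close>.\<close>

lemma gauss_front:
  assumes "u \<in> U" "\<rho> u \<noteq> 0"
  shows "sectional_curvature (induced_metric f) u x y
    = (h u x x * h u y y - (h u x y)\<^sup>2) / ((df u x \<bullet> df u x) * (df u y \<bullet> df u y) - (df u x \<bullet> df u y)\<^sup>2)"
proof -
  define V where "V = {q \<in> U. \<rho> q \<noteq> 0}"
  have "continuous_on U \<rho>"
    using diff_\<rho> by (auto intro!: continuous_at_imp_continuous_on differentiable_imp_continuous_within)
  moreover have V_eq: "V = U \<inter> \<rho> -` (- {0})" by (auto simp: V_def)
  ultimately have V: "open V"
    using continuous_open_preimage[OF _ open_U open_Compl[OF closed_singleton]] by metis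
  have smooth_V: "smooth_on V f"
    using smooth_f smooth_on_subset[of V U f] by (auto simp: V_def)
  have u: "u \<in> V" using assms by (simp add: V_def)
  have "metric_at (induced_metric f) u (curvature_operator (induced_metric f) u x y y) x
      = h u x x * h u y y - (h u x y)\<^sup>2"
    unfolding h_eq[OF assms(1)]
  proof (rule gauss_equation[OF V smooth_V _ u])
    show "immersion_at f q" if "q \<in> V" for q
      using that by (simp add: V_def density_nonzero_imp_immersion)
    show "z \<bullet> second_derivative f u x y = 0"
      if "\<And>v. z \<bullet> df u v = 0" "z \<bullet> \<nu> u = 0" for z x y
      using normal_trivial[OF assms(2) that] by simp
  qed (simp_all add: df_\<nu> unit assms(1))
  then show ?thesis
    unfolding sectional_curvature_def by (simp add: metric_at_induced_metric[OF diff_f[OF assms(1)]])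
qed

section \<open>First-order expansions along lines\<close>

lemma derivative_along_line:
  fixes g :: "real^'n \<Rightarrow> 'b::real_inner"
  assumes "g differentiable (at u)"
  shows "((\<lambda>t. g (u + t *\<^sub>R v)) has_vector_derivative frechet_derivative g (at u) v) (at 0)"
  using has_vector_derivative_along_line[of g u 0 v] assms by simp

lemma inner_derivative_along_line:
  fixes a b :: "real^'n \<Rightarrow> real^('n option)"
  assumes "a differentiable (at u)" "b differentiable (at u)"
  shows "((\<lambda>t. a (u + t *\<^sub>R v) \<bullet> b (u + t *\<^sub>R v)) has_real_derivative
     (a u \<bullet> frechet_derivative b (at u) v + frechet_derivative a (at u) v \<bullet> b u)) (at 0)"
  using derivative_along_line[of "\<lambda>q. a q \<bullet> b q" u v] assms
  by (simp add: has_real_derivative_iff_has_vector_derivative frechet_derivative_inner)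

text \<open>The derivative of \<open>h\<close> at \<open>u\<close> in direction \<open>v\<close>,
  with \<open>x\<close> and \<open>y\<close> held constant.\<close>

definition dh :: "real^'n \<Rightarrow> real^'n \<Rightarrow> real^'n \<Rightarrow> real^'n \<Rightarrow> real" where
  "dh u v x y = - (df u x \<bullet> second_derivative \<nu> u y v + second_derivative f u x v \<bullet> d\<nu> u y)"

lemma h_along_line:
  assumes "u \<in> U"
  shows "((\<lambda>t. h (u + t *\<^sub>R v) x y) has_real_derivative dh u v x y) (at 0)"
  unfolding second_fundamental_form_def dh_def
  by (intro DERIV_minus inner_derivative_along_line diff_df diff_d\<nu> assms)

text \<open>\<open>z\<close> and the extension of \<open>e\<close> by 0 are left and right kernel
  vectors of \<open>J u\<close>, so \<open>det_derivative_kernels\<close> applies to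
  \<open>J\<close> along \<open>u + t v\<close>. Suitable choices of \<open>e\<close> and
  \<open>z\<close> yield a nonvanishing pairing and bound the dimensions of both kernels.\<close>

lemma density_kernels:
  assumes u: "u \<in> U" and v: "d\<rho> u v \<noteq> 0" and e: "df u e = 0" "e \<noteq> 0"
    and z: "\<And>x. z \<bullet> df u x = 0" "z \<bullet> \<nu> u = 0" "z \<noteq> 0"
  shows "z \<bullet> second_derivative f u e v \<noteq> 0"
proof -
  define E where "E = (\<chi> b. case b of Some i \<Rightarrow> e $ i | None \<Rightarrow> 0)"
  define M' where "M' = (\<chi> a b. (case b of Some i \<Rightarrow> second_derivative f u (axis i 1) v | None \<Rightarrow> d\<nu> u v) $ a)"
  have "((\<lambda>t. J (u + t *\<^sub>R v) $ a $ b) has_real_derivative M' $ a $ b) (at 0)" for a b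
  proof (cases b)
    case None
    show ?thesis
      using has_vector_derivative_along_line[of \<nu> u 0 v] diff_\<nu>[OF u] unfolding None
      by (auto simp: J_def M'_def has_real_derivative_iff_has_vector_derivative
          dest: bounded_linear.has_vector_derivative[OF bounded_linear_vec_nth])
  next
    case (Some i)
    show ?thesis
      using has_vector_derivative_along_line[of "\<lambda>q. df q (axis i 1)" u 0 v] diff_df[OF u] unfolding Some
      by (auto simp: J_def M'_def has_real_derivative_iff_has_vector_derivative partial_deriv_def
          dest: bounded_linear.has_vector_derivative[OF bounded_linear_vec_nth])
  qed
  moreover have "((\<lambda>t. det (J (u + t *\<^sub>R v))) has_real_derivative d\<rho> u v) (at 0)"
    using derivative_along_line[OF diff_\<rho>[OF u], of v] unfolding signed_density_J[abs_def]
    by (simp add: has_real_derivative_iff_has_vector_derivative)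
  moreover have "J u *v E = 0"
    using e(1) unfolding E_def J_mult by (simp add: frechet_derivative_partials[OF diff_f[OF u]])
  moreover have "E \<noteq> 0"
  proof
    assume "E = 0"
    then have "E $ Some i = 0" for i by simp
    then show False using e(2) by (simp add: E_def vec_eq_iff)
  qed
  ultimately have "z \<bullet> (M' *v E) \<noteq> 0"
    using det_derivative_kernels[of "\<lambda>t. J (u + t *\<^sub>R v)" M' "d\<rho> u v" z E] v z kernel_J[OF z(1,2)] by simp
  moreover have "M' *v E = (\<Sum>i\<in>UNIV. e $ i *\<^sub>R second_derivative f u (axis i 1) v)"
    by (simp add: vec_eq_iff M'_def E_def matrix_vector_mult_def sum_option mult.commute)
  moreover have "\<dots> = second_derivative f u (\<Sum>i\<in>UNIV. e $ i *\<^sub>R axis i 1) v"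
    by (simp add: linear_sum[OF linear_d2f[OF u]] linear_scale[OF linear_d2f[OF u]])
  moreover have "(\<Sum>i\<in>UNIV. e $ i *\<^sub>R axis i 1) = e"
    by (simp add: basis_expansion scalar_mult_eq_scaleR[symmetric])
  ultimately show ?thesis by simp
qed

section \<open>Singular points\<close>

text \<open>The analytic form of transversality: tangent vectors of the singular set are killed by
  \<open>d\<rho>\<close>, while \<open>e\<close> is not.\<close>

definition null_direction :: "real^'n \<Rightarrow> real^'n \<Rightarrow> bool" where
  "null_direction u e \<longleftrightarrow> u \<in> singular_set U f \<and> df u e = 0 \<and> d\<rho> u e \<noteq> 0"

lemma tangent_space_kernel:
  assumes "v \<in> tangent_space (singular_set U f) u"
  shows "d\<rho> u v = 0"
proof -
  obtain c \<epsilon> where c: "\<epsilon> > 0" "c ` {-\<epsilon><..<\<epsilon>} \<subseteq> singular_set U f" "c 0 = u"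
    "(c has_vector_derivative v) (at (0::real))"
    using assms by (auto simp: tangent_space_def)
  have "c 0 \<in> singular_set U f" using c by auto
  then have u: "u \<in> U" using c(3) by (simp add: singular_set_def)
  have "(\<rho> has_derivative d\<rho> u) (at (c 0))"
    using diff_\<rho>[OF u] c(3) by (simp add: frechet_derivative_works)
  then have "((\<lambda>t. \<rho> (c t)) has_vector_derivative d\<rho> u v) (at 0)"
    using vector_derivative_diff_chain_within[OF c(4) has_derivative_at_withinI] unfolding o_def by blast
  moreover have "((\<lambda>t. \<rho> (c t)) has_vector_derivative 0) (at 0)"
  proof (rule has_vector_derivative_transform_within_open[OF has_vector_derivative_const])
    show "0 = \<rho> (c t)" if "t \<in> {-\<epsilon><..<\<epsilon>}" for t
      using c(2) that singular_density by fastforce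
  qed (use c(1) in auto)
  ultimately show ?thesis using vector_derivative_unique_at by blast
qed

text \<open>If \<open>d\<rho>\<close> vanished on the null space, it would vanish on its sum with
  the tangent space, hence everywhere, against non-degeneracy.\<close>

lemma cuspidal_edge_null_direction:
  assumes "cuspidal_edge U f \<nu> u"
  shows "\<exists>e. null_direction u e"
proof (rule ccontr)
  assume none: "\<nexists>e. null_direction u e"
  have u: "u \<in> singular_set U f" "u \<in> U" "d\<rho> u \<noteq> (\<lambda>x. 0)"
    and span: "{v + w | v w. v \<in> null_space f u \<and> w \<in> tangent_space (singular_set U f) u} = UNIV"
    using assms by (auto simp: cuspidal_edge_def nondegenerate_singular_point_def singular_set_def)
  have "d\<rho> u x = 0" for x
  proof -
    obtain v w where "x = v + w" "v \<in> null_space f u" "w \<in> tangent_space (singular_set U f) u"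
      using span by blast
    then show ?thesis
      using none u tangent_space_kernel linear_add[OF linear_d\<rho>[OF u(2)]]
      by (auto simp: null_direction_def null_space_def)
  qed
  then show False using u(3) by auto
qed

context
  fixes u e :: "real^'n"
  assumes null: "null_direction u e"
begin

section \<open>Kernel and normal space at a singular point\<close>

lemma singular: "u \<in> singular_set U f" and in_U: "u \<in> U" and df_e: "df u e = 0" and d\<rho>_e: "d\<rho> u e \<noteq> 0"
  using null by (auto simp: null_direction_def singular_set_def)

lemma e_nonzero: "e \<noteq> 0"
  using d\<rho>_e linear_0[OF linear_d\<rho>[OF in_U]] by metis

text \<open>\<open>df e\<close> vanishes and the pair (f, \<nu>) is an immersion.\<close>

lemma d\<nu>_e_nonzero: "d\<nu> u e \<noteq> 0"
proof
  assume "d\<nu> u e = 0"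
  have "((\<lambda>w. (f w, \<nu> w)) has_derivative (\<lambda>x. (df u x, d\<nu> u x))) (at u)"
    by (intro has_derivative_Pair has_derivative_frechet diff_f diff_\<nu> in_U)
  from frechet_derivative_at[OF this] have D: "frechet_derivative (\<lambda>w. (f w, \<nu> w)) (at u) = (\<lambda>x. (df u x, d\<nu> u x))" ..
  have "inj (\<lambda>x. (df u x, d\<nu> u x))"
    using lift_immersion[OF in_U] unfolding immersion_at_def D by simp
  moreover have "(df u e, d\<nu> u e) = (df u 0, d\<nu> u 0)"
    using df_e \<open>d\<nu> u e = 0\<close> linear_0[OF linear_df[OF in_U]] linear_0[OF linear_d\<nu>[OF in_U]] by simp
  ultimately have "e = 0" by (rule injD)
  then show False using e_nonzero by simp
qed

text \<open>The first product is, up to sign, \<open>h u x e\<close>, which vanishes by symmetry of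
  \<open>h\<close>; the second comes from \<nu> having unit length.\<close>

lemma d\<nu>_e_normal: "d\<nu> u e \<bullet> df u x = 0" "d\<nu> u e \<bullet> \<nu> u = 0"
  using h_null(2)[OF in_U df_e, of x] d\<nu>_\<nu>[OF in_U]
  by (simp_all add: second_fundamental_form_def inner_commute)

lemma cross_nonzero: "d\<nu> u e \<bullet> second_derivative f u e e \<noteq> 0"
  by (rule density_kernels[OF in_U d\<rho>_e df_e e_nonzero d\<nu>_e_normal d\<nu>_e_nonzero])

lemma dh_e_nonzero: "dh u e e e \<noteq> 0"
  using cross_nonzero by (simp add: dh_def df_e inner_commute)

text \<open>The multiple \<open>r\<close> is chosen to make the pairing of
  \<open>density_kernels\<close> vanish for \<open>x - r *\<^sub>R e\<close>, which forces this null
  vector to be zero.\<close>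

lemma null_space_line:
  assumes "df u x = 0"
  shows "\<exists>r. x = r *\<^sub>R e"
proof -
  define r where "r = (d\<nu> u e \<bullet> second_derivative f u x e) / (d\<nu> u e \<bullet> second_derivative f u e e)"
  have "d\<nu> u e \<bullet> second_derivative f u (x - r *\<^sub>R e) e = 0"
    using cross_nonzero
    by (simp add: r_def linear_diff[OF linear_d2f[OF in_U]] linear_scale[OF linear_d2f[OF in_U]] inner_diff_right)
  moreover have "df u (x - r *\<^sub>R e) = 0"
    using assms df_e by (simp add: linear_diff[OF linear_df[OF in_U]] linear_scale[OF linear_df[OF in_U]])
  ultimately have "x - r *\<^sub>R e = 0"
    using density_kernels[OF in_U d\<rho>_e, of "x - r *\<^sub>R e" "d\<nu> u e"] d\<nu>_e_normal d\<nu>_e_nonzero by blast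
  then show ?thesis by auto
qed

text \<open>Dual to \<open>null_space_line\<close>: the normal vectors orthogonal to \<nu> form the
  line spanned by \<open>d\<nu> u e\<close>, so only the \<nu>-component of \<open>z\<close>
  remains.\<close>

lemma normal_space:
  assumes "\<And>x. z \<bullet> df u x = 0" "z \<bullet> d\<nu> u e = 0"
  shows "z = (z \<bullet> \<nu> u) *\<^sub>R \<nu> u"
proof -
  define y where "y = z - (z \<bullet> \<nu> u) *\<^sub>R \<nu> u"
  have nn: "\<nu> u \<bullet> \<nu> u = 1" using unit[OF in_U] by (simp add: dot_square_norm)
  have \<nu>_df: "\<nu> u \<bullet> df u x = 0" "\<nu> u \<bullet> d\<nu> u e = 0" for x
    using df_\<nu>[OF in_U] d\<nu>_e_normal(2) by (simp_all only: inner_commute[of "\<nu> u"])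
  have y: "y \<bullet> df u x = 0" "y \<bullet> \<nu> u = 0" for x
    using assms(1) \<nu>_df nn by (simp_all add: y_def inner_diff_left)
  \<comment> \<open>Makes \<open>y - c *\<^sub>R d\<nu> u e\<close> violate the conclusion of
    \<open>density_kernels\<close> unless it is zero.\<close>
  define c where "c = (y \<bullet> second_derivative f u e e) / (d\<nu> u e \<bullet> second_derivative f u e e)"
  have "(y - c *\<^sub>R d\<nu> u e) \<bullet> second_derivative f u e e = 0"
    using cross_nonzero by (simp add: c_def inner_diff_left)
  moreover have "(y - c *\<^sub>R d\<nu> u e) \<bullet> df u x = 0" "(y - c *\<^sub>R d\<nu> u e) \<bullet> \<nu> u = 0" for x
    using y d\<nu>_e_normal by (simp_all add: inner_diff_left)
  ultimately have yc: "y = c *\<^sub>R d\<nu> u e"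
    using density_kernels[OF in_U d\<rho>_e df_e e_nonzero, of "y - c *\<^sub>R d\<nu> u e"] by fastforce
  have "y \<bullet> d\<nu> u e = 0"
    using assms(2) \<nu>_df by (simp add: y_def inner_diff_left)
  then have "y = 0" using d\<nu>_e_nonzero unfolding yc by simp
  then show ?thesis by (simp add: y_def)
qed

section \<open>Curvature near a singular point along its null direction\<close>

text \<open>\<rho> has a simple zero at \<open>t = 0\<close> along this line.\<close>

lemma eventually_regular: "\<forall>\<^sub>F t in at 0. u + t *\<^sub>R e \<in> U \<and> \<rho> (u + t *\<^sub>R e) \<noteq> 0"
proof -
  have "((\<lambda>t. \<rho> (u + t *\<^sub>R e)) has_real_derivative d\<rho> u e) (at 0)"
    using derivative_along_line[OF diff_\<rho>[OF in_U]] by (simp add: has_real_derivative_iff_has_vector_derivative)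
  then have "((\<lambda>t. \<rho> (u + t *\<^sub>R e) / t) \<longlongrightarrow> d\<rho> u e) (at 0)"
    by (rule has_real_derivative_quotient_limit) (simp add: singular_density[OF singular])
  then have "\<forall>\<^sub>F t in at 0. \<rho> (u + t *\<^sub>R e) / t \<noteq> 0"
    using d\<rho>_e by (rule tendsto_imp_eventually_ne)
  moreover have "((\<lambda>t. u + t *\<^sub>R e) \<longlongrightarrow> u + 0 *\<^sub>R e) (at 0)"
    by (intro tendsto_intros)
  then have "\<forall>\<^sub>F t in at 0. u + t *\<^sub>R e \<in> U"
    using topological_tendstoD[of _ "u + 0 *\<^sub>R e" _ U] open_U in_U by simp
  ultimately show ?thesis by eventually_elim auto
qed

definition h_minor :: "real^'n \<Rightarrow> real^'n \<Rightarrow> real \<Rightarrow> real" where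
  "h_minor x y t = h (u + t *\<^sub>R e) x x * h (u + t *\<^sub>R e) y y - (h (u + t *\<^sub>R e) x y)\<^sup>2"

definition gram :: "real^'n \<Rightarrow> real^'n \<Rightarrow> real \<Rightarrow> real" where
  "gram x y t = (df (u + t *\<^sub>R e) x \<bullet> df (u + t *\<^sub>R e) x) * (df (u + t *\<^sub>R e) y \<bullet> df (u + t *\<^sub>R e) y)
     - (df (u + t *\<^sub>R e) x \<bullet> df (u + t *\<^sub>R e) y)\<^sup>2"

text \<open>The product form allows passing to the limit at \<open>t = 0\<close>, where
  \<open>gram\<close> may vanish.\<close>

lemma eventually_gauss:
  assumes "spans_plane x y"
  shows "\<forall>\<^sub>F t in at 0. u + t *\<^sub>R e \<in> regular_set U f \<and> gram x y t > 0 \<and>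
     h_minor x y t = sectional_curvature (induced_metric f) (u + t *\<^sub>R e) x y * gram x y t"
  using eventually_regular
proof eventually_elim
  case (elim t)
  then have imm: "immersion_at f (u + t *\<^sub>R e)" using density_nonzero_imp_immersion by blast
  have "spans_plane (df (u + t *\<^sub>R e) x) (df (u + t *\<^sub>R e) y)"
    using spans_plane_linear_image[OF linear_df _ assms] imm elim by (simp add: immersion_at_def)
  then have "gram x y t > 0"
    unfolding gram_def by (rule gram_pos)
  moreover have "sectional_curvature (induced_metric f) (u + t *\<^sub>R e) x y = h_minor x y t / gram x y t"
    unfolding gram_def h_minor_def using elim by (intro gauss_front) simp_all
  ultimately show ?case using elim imm by (simp add: regular_set_def)
qed

text \<open>At \<open>t = 0\<close> both \<open>h e e\<close> and \<open>h x e\<close> vanish, so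
  only the term differentiating \<open>h e e\<close> survives.\<close>

lemma h_minor_e_derivative: "(h_minor x e has_real_derivative h u x x * dh u e e e) (at 0)"
  unfolding h_minor_def
  by (rule derivative_eq_intros h_along_line in_U refl)+ (simp add: h_null[OF in_U df_e])

text \<open>Every term is quadratic in \<open>df e\<close>, which vanishes at
  \<open>u\<close>.\<close>

lemma gram_e_derivative: "(gram x e has_real_derivative 0) (at 0)"
  unfolding gram_def
  by (rule derivative_eq_intros inner_derivative_along_line diff_df in_U refl)+ (simp add: df_e)

lemma h_diagonal_zero:
  assumes "\<And>x. spans_plane x e \<Longrightarrow> h u x x * dh u e e e = 0"
  shows "h u x y = 0"
proof (rule h_zero_of_diagonal[OF in_U])
  fix x
  show "h u x x = 0"
  proof (cases "spans_plane x e")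
    case True
    then show ?thesis using assms dh_e_nonzero by simp
  next
    case False
    then obtain r where "x = r *\<^sub>R e" using not_spans_plane_imp_multiple e_nonzero by blast
    then have "df u x = 0" using df_e by (simp add: linear_scale[OF linear_df[OF in_U]])
    then show ?thesis by (simp add: h_null[OF in_U])
  qed
qed

text \<open>Dividing the Gauss equation by \<open>t\<close> bounds a quotient with limit
  \<open>h u x x * dh u e e e\<close> by \<open>C\<close> times one that tends to 0.\<close>

lemma bounded_curvature_imp_h_zero:
  assumes "\<And>q x y. \<lbrakk>q \<in> regular_set U f; spans_plane x y\<rbrakk> \<Longrightarrow> \<bar>sectional_curvature (induced_metric f) q x y\<bar> \<le> C"
  shows "h u x y = 0"
proof (rule h_diagonal_zero)
  fix x assume xe: "spans_plane x e"
  have "((\<lambda>t. h_minor x e t / t) \<longlongrightarrow> h u x x * dh u e e e) (at 0)"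
    by (rule has_real_derivative_quotient_limit[OF h_minor_e_derivative]) (simp add: h_minor_def h_null[OF in_U df_e])
  then have lim: "((\<lambda>t. \<bar>h_minor x e t / t\<bar>) \<longlongrightarrow> \<bar>h u x x * dh u e e e\<bar>) (at 0)"
    by (rule tendsto_rabs)
  have "((\<lambda>t. gram x e t / t) \<longlongrightarrow> 0) (at 0)"
    by (rule has_real_derivative_quotient_limit[OF gram_e_derivative]) (simp add: gram_def df_e)
  then have lim0: "((\<lambda>t. C * \<bar>gram x e t / t\<bar>) \<longlongrightarrow> C * \<bar>0\<bar>) (at 0)"
    by (intro tendsto_mult_left tendsto_rabs)
  have "\<forall>\<^sub>F t in at 0. \<bar>h_minor x e t / t\<bar> \<le> C * \<bar>gram x e t / t\<bar>"
    using eventually_gauss[OF xe]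
  proof eventually_elim
    case (elim t)
    then have "\<bar>h_minor x e t\<bar> \<le> C * \<bar>gram x e t\<bar>"
      using assms[OF _ xe] by (auto simp: abs_mult intro: mult_right_mono)
    then have "\<bar>h_minor x e t\<bar> / \<bar>t\<bar> \<le> C * \<bar>gram x e t\<bar> / \<bar>t\<bar>" by (rule divide_right_mono) simp
    then show ?case by simp
  qed
  then have "\<bar>h u x x * dh u e e e\<bar> \<le> C * \<bar>0\<bar>"
    by (rule tendsto_le[OF _ lim0 lim, rotated]) simp
  then show "h u x x * dh u e e e = 0" by simp
qed

text \<open>
  The minor \<open>h(x,x) h(e,e) - h(x,e)\<^sup>2\<close> vanishes at \<open>u\<close> and is positive on both sides of the
  singular set, so its derivative along \<open>e\<close> is zero.
\<close>

lemma positive_curvature_imp_h_zero: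
  assumes "\<And>q x y. \<lbrakk>q \<in> regular_set U f; spans_plane x y\<rbrakk> \<Longrightarrow> sectional_curvature (induced_metric f) q x y > 0"
  shows "h u x y = 0"
proof (rule h_diagonal_zero)
  fix x assume xe: "spans_plane x e"
  have h0: "h_minor x e 0 = 0" by (simp add: h_minor_def h_null[OF in_U df_e])
  have "\<forall>\<^sub>F t in at 0. h_minor x e 0 \<le> h_minor x e t"
    using eventually_gauss[OF xe]
  proof eventually_elim
    case (elim t)
    then show ?case using assms[OF _ xe] h0 by (simp add: less_imp_le)
  qed
  then obtain d where d: "d > 0" "\<And>t. t \<noteq> 0 \<Longrightarrow> dist t 0 < d \<Longrightarrow> h_minor x e 0 \<le> h_minor x e t"
    by (auto simp: eventually_at)
  have "h_minor x e 0 \<le> h_minor x e t" if "\<bar>0 - t\<bar> < d" for t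
    using d(2)[of t] that by (cases "t = 0") (auto simp: dist_real_def)
  then show "h u x x * dh u e e e = 0"
    using DERIV_local_min[OF h_minor_e_derivative d(1)] by blast
qed

text \<open>Each entry of \<open>h\<close> vanishes at \<open>t = 0\<close>, so its quotient by
  \<open>t\<close> tends to the entry of \<open>dh\<close>.\<close>

lemma h_minor_quotient_limit:
  assumes "\<And>x y. h u x y = 0"
  shows "((\<lambda>t. h_minor x y t / t\<^sup>2) \<longlongrightarrow> dh u e x x * dh u e y y - (dh u e x y)\<^sup>2) (at 0)"
proof -
  have q: "((\<lambda>t. h (u + t *\<^sub>R e) a b / t) \<longlongrightarrow> dh u e a b) (at 0)" for a b
    by (rule has_real_derivative_quotient_limit[OF h_along_line[OF in_U]]) (simp add: assms)
  have "h_minor x y t / t\<^sup>2 = (h (u + t *\<^sub>R e) x x / t) * (h (u + t *\<^sub>R e) y y / t) - (h (u + t *\<^sub>R e) x y / t)\<^sup>2" for t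
    by (simp add: h_minor_def power2_eq_square diff_divide_distrib)
  then show ?thesis by (simp only:) (intro tendsto_intros q)
qed

lemma positive_curvature_imp_dh_minor_nonneg:
  assumes "\<And>q x y. \<lbrakk>q \<in> regular_set U f; spans_plane x y\<rbrakk> \<Longrightarrow> sectional_curvature (induced_metric f) q x y > 0"
    and "spans_plane x y"
  shows "dh u e x x * dh u e y y - (dh u e x y)\<^sup>2 \<ge> 0"
proof (rule tendsto_lowerbound[OF h_minor_quotient_limit])
  show "\<forall>\<^sub>F t in at 0. 0 \<le> h_minor x y t / t\<^sup>2"
    using eventually_gauss[OF assms(2)]
    by eventually_elim (auto simp: less_imp_le assms)
qed (use positive_curvature_imp_h_zero assms(1) in auto)

text \<open>
  Off the singular set \<open>h_minor\<close> is the curvature times \<open>gram\<close>; at \<open>u\<close> the former is \<open>0\<close> and the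
  latter is positive on planes transversal to \<open>e\<close>.
\<close>

lemma no_positive_lower_curvature_bound:
  assumes "\<delta> > 0"
    and K: "\<And>q x y. \<lbrakk>q \<in> regular_set U f; spans_plane x y\<rbrakk> \<Longrightarrow> sectional_curvature (induced_metric f) q x y \<ge> \<delta>"
    and xy: "spans_plane (df u x) (df u y)"
  shows False
proof -
  have "h u a b = 0" for a b
    using positive_curvature_imp_h_zero K assms(1) by (meson less_le_trans)
  then have h0: "h_minor x y 0 = 0" by (simp add: h_minor_def)
  have "isCont (h_minor x y) 0"
    unfolding h_minor_def by (intro continuous_intros DERIV_isCont[OF h_along_line[OF in_U]])
  then have 1: "(h_minor x y \<longlongrightarrow> 0) (at 0)" using h0 by (simp add: isCont_def)
  have "isCont (gram x y) 0"
    unfolding gram_def by (intro continuous_intros DERIV_isCont[OF inner_derivative_along_line[OF diff_df diff_df]] in_U)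
  then have 2: "((\<lambda>t. \<delta> * gram x y t) \<longlongrightarrow> \<delta> * gram x y 0) (at 0)"
    by (intro tendsto_mult_left) (simp add: isCont_def)
  have pl: "spans_plane x y"
    unfolding spans_plane_iff
  proof (intro allI impI)
    fix a b assume "a *\<^sub>R x + b *\<^sub>R y = 0"
    moreover have "a *\<^sub>R df u x + b *\<^sub>R df u y = df u (a *\<^sub>R x + b *\<^sub>R y)"
      by (simp add: linear_add[OF linear_df[OF in_U]] linear_scale[OF linear_df[OF in_U]])
    ultimately have "a *\<^sub>R df u x + b *\<^sub>R df u y = 0"
      using linear_0[OF linear_df[OF in_U]] by simp
    then show "a = 0 \<and> b = 0" using xy by (simp add: spans_plane_iff)
  qed
  have "\<forall>\<^sub>F t in at 0. \<delta> * gram x y t \<le> h_minor x y t"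
    using eventually_gauss[OF pl]
    by eventually_elim (auto simp: K pl intro!: mult_right_mono)
  then have "\<delta> * gram x y 0 \<le> 0"
    by (rule tendsto_le[OF _ 1 2, rotated]) simp
  moreover have "gram x y 0 > 0" using gram_pos[OF xy] by (simp add: gram_def)
  ultimately show False using assms(1) by (simp add: mult_le_0_iff)
qed

end

section \<open>The singular submanifold\<close>

context
  fixes V :: "(real^'m::finite) set" and \<phi> :: "real^'m \<Rightarrow> real^'n"
  assumes card: "CARD('n) = CARD('m) + 1"
    and param: "local_parametrization (singular_set U f) V \<phi>"
begin

abbreviation "d\<phi> q \<equiv> frechet_derivative \<phi> (at q)"
abbreviation "dF q \<equiv> frechet_derivative (f \<circ> \<phi>) (at q)"

lemma open_V: "open V" and smooth_\<phi>: "smooth_on V \<phi>" and inj_d\<phi>: "q \<in> V \<Longrightarrow> inj (d\<phi> q)"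
  and \<phi>_singular: "q \<in> V \<Longrightarrow> \<phi> q \<in> singular_set U f"
  using param openin_imp_subset by (fastforce simp: local_parametrization_def immersion_at_def)+

lemma \<phi>_U: "q \<in> V \<Longrightarrow> \<phi> q \<in> U"
  using \<phi>_singular by (simp add: singular_set_def)

lemmas diff_\<phi> = smooth_on_differentiable[OF smooth_\<phi>]

lemma linear_d\<phi>: "q \<in> V \<Longrightarrow> linear (d\<phi> q)"
  by (intro linear_frechet_derivative diff_\<phi>)

lemma smooth_F: "smooth_on V (f \<circ> \<phi>)"
  by (rule smooth_on_comp[OF open_V smooth_\<phi> smooth_f]) (use \<phi>_U in auto)

lemma dF: "q \<in> V \<Longrightarrow> dF q x = df (\<phi> q) (d\<phi> q x)"
  by (rule frechet_derivative_comp(2)) (auto intro: diff_\<phi> diff_f \<phi>_U)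

lemma d\<rho>_tangent: assumes "q \<in> V" shows "d\<rho> (\<phi> q) (d\<phi> q x) = 0"
proof -
  have "frechet_derivative (\<rho> \<circ> \<phi>) (at q) x = 0"
    by (rule frechet_derivative_zero_on[OF open_V assms]) (simp add: singular_density \<phi>_singular)
  then show ?thesis
    using frechet_derivative_comp(2)[OF diff_\<phi>[OF assms] diff_\<rho>[OF \<phi>_U[OF assms]]] by simp
qed

text \<open>If \<open>dF b\<close> vanishes, then \<open>d\<phi> b\<close> is a multiple of
  \<open>e\<close>; since \<open>d\<rho>\<close> kills it but not \<open>e\<close>, the multiple is
  zero.\<close>

lemma immersion_F:
  assumes "q \<in> V" "null_direction (\<phi> q) e"
  shows "immersion_at (f \<circ> \<phi>) q"
proof -
  have "b = 0" if "dF q b = 0" for b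
  proof -
    have "df (\<phi> q) (d\<phi> q b) = 0" using that by (simp add: dF assms(1))
    then obtain r where r: "d\<phi> q b = r *\<^sub>R e"
      using null_space_line[OF assms(2)] by blast
    then have "r * d\<rho> (\<phi> q) e = 0"
      using d\<rho>_tangent[OF assms(1), of b] linear_scale[OF linear_d\<rho>[OF \<phi>_U[OF assms(1)]]] by simp
    then have "d\<phi> q b = d\<phi> q 0"
      using r d\<rho>_e[OF assms(2)] linear_0[OF linear_d\<phi>[OF assms(1)]] by simp
    then show ?thesis using inj_d\<phi>[OF assms(1)] by (simp add: injD)
  qed
  moreover have "(f \<circ> \<phi>) differentiable (at q)" by (rule smooth_on_differentiable[OF smooth_F assms(1)])
  ultimately show ?thesis
    using linear_injective_0[OF linear_frechet_derivative] by (auto simp: immersion_at_def)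
qed

text \<open>The range of \<open>d\<phi>\<close> has codimension one by \<open>card\<close> and does
  not contain \<open>e\<close>, because \<open>d\<rho>\<close> vanishes on it.\<close>

lemma transversal_decomposition:
  assumes "q \<in> V" "null_direction (\<phi> q) e"
  shows "\<exists>b r. a = d\<phi> q b + r *\<^sub>R e"
proof -
  have sub: "subspace (range (d\<phi> q))"
    using linear_subspace_image[OF linear_d\<phi>[OF assms(1)] subspace_UNIV] .
  have "e \<notin> range (d\<phi> q)" using d\<rho>_tangent[OF assms(1)] d\<rho>_e[OF assms(2)] by auto
  moreover have "dim (range (d\<phi> q)) = CARD('m)"
    using dim_image_eq[OF linear_d\<phi>[OF assms(1)], of UNIV] inj_d\<phi>[OF assms(1)] by simp
  ultimately have "dim (insert e (range (d\<phi> q))) = DIM(real^'n)"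
    unfolding dim_insert span_eq_iff[THEN iffD2, OF sub] using card by simp
  then have "a \<in> span (insert e (range (d\<phi> q)))" using dim_eq_full by blast
  then obtain r where "a - r *\<^sub>R e \<in> range (d\<phi> q)"
    unfolding span_breakdown_eq span_eq_iff[THEN iffD2, OF sub] by blast
  then show ?thesis by (metis diff_add_cancel imageE)
qed

context
  fixes q :: "real^'m" and e :: "real^'n"
  assumes q: "q \<in> V" and null: "null_direction (\<phi> q) e"
    and flat: "\<And>u x y. u \<in> singular_set U f \<Longrightarrow> h u x y = 0"
begin

section \<open>The second fundamental form and curvature of the singular submanifold\<close>

lemma diff_dF: "(\<lambda>p. dF p x) differentiable (at q)"
  by (rule smooth_on_differentiable[OF smooth_on_frechet_derivative[OF smooth_F] q])

lemma derivative_comp_\<phi>: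
  fixes g :: "real^'n \<Rightarrow> 'b::real_normed_vector"
  assumes "g differentiable (at (\<phi> q))"
  shows "(\<lambda>p. g (\<phi> p)) differentiable (at q)"
    and "frechet_derivative (\<lambda>p. g (\<phi> p)) (at q) y = frechet_derivative g (at (\<phi> q)) (d\<phi> q y)"
  using frechet_derivative_comp[OF diff_\<phi>[OF q] assms] by (simp_all add: o_def)

text \<open>Differentiating the orthogonality of \<open>dF x\<close> and \<nu> leaves a value of
  \<open>h\<close> on the singular set, which is zero by \<open>flat\<close>.\<close>

lemma d2F_\<nu>: "second_derivative (f \<circ> \<phi>) q x y \<bullet> \<nu> (\<phi> q) = 0"
proof -
  have "frechet_derivative (\<lambda>p. dF p x \<bullet> \<nu> (\<phi> p)) (at q) y = 0"
    by (rule frechet_derivative_zero_on[OF open_V q]) (simp add: dF df_\<nu> \<phi>_U)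
  moreover have "dF q x \<bullet> d\<nu> (\<phi> q) (d\<phi> q y) = 0"
    using flat[OF \<phi>_singular[OF q], of "d\<phi> q x" "d\<phi> q y"] by (simp add: dF q second_fundamental_form_def)
  ultimately show ?thesis
    using frechet_derivative_inner[OF diff_dF derivative_comp_\<phi>(1)[OF diff_\<nu>[OF \<phi>_U[OF q]]], of x y]
      derivative_comp_\<phi>(2)[OF diff_\<nu>[OF \<phi>_U[OF q]], of y] by simp
qed

text \<open>Since \<open>h(e, \<cdot>)\<close> vanishes along the singular set, so do its tangential derivatives.\<close>

lemma d2f_tangent_null: "second_derivative f (\<phi> q) (d\<phi> q x) e \<bullet> d\<nu> (\<phi> q) y = 0"
proof -
  note u = \<phi>_U[OF q]
  have "frechet_derivative (\<lambda>p. df (\<phi> p) e \<bullet> d\<nu> (\<phi> p) y) (at q) x = 0"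
    using flat[OF \<phi>_singular, of _ e y]
    by (intro frechet_derivative_zero_on[OF open_V q]) (simp add: second_fundamental_form_def)
  then have "second_derivative f (\<phi> q) e (d\<phi> q x) \<bullet> d\<nu> (\<phi> q) y = 0"
    using frechet_derivative_inner[OF derivative_comp_\<phi>(1)[OF diff_df[OF u]] derivative_comp_\<phi>(1)[OF diff_d\<nu>[OF u]], of e y x]
      derivative_comp_\<phi>(2)[OF diff_df[OF u], of e x] df_e[OF null] by simp
  then show ?thesis by (simp add: d2f_sym[OF u])
qed

text \<open>The function \<open>dF p x \<bullet> d\<nu> (\<phi> p) e\<close> is, up to sign, a value
  of \<open>h\<close> with \<open>e\<close> held fixed. It vanishes by \<open>flat\<close> even
  where \<open>e\<close> is not null, and its derivative gives one half of \<open>dh\<close>; the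
  other half is zero by \<open>d2f_tangent_null\<close>.\<close>

lemma d2F_d\<nu>: "second_derivative (f \<circ> \<phi>) q x y \<bullet> d\<nu> (\<phi> q) e = dh (\<phi> q) e (d\<phi> q x) (d\<phi> q y)"
proof -
  note u = \<phi>_U[OF q]
  have "frechet_derivative (\<lambda>p. dF p x \<bullet> d\<nu> (\<phi> p) e) (at q) y = 0"
    using flat[OF \<phi>_singular, of _ "d\<phi> _ x" e]
    by (intro frechet_derivative_zero_on[OF open_V q]) (simp add: dF second_fundamental_form_def)
  then have "second_derivative (f \<circ> \<phi>) q x y \<bullet> d\<nu> (\<phi> q) e
      = - (dF q x \<bullet> second_derivative \<nu> (\<phi> q) e (d\<phi> q y))"
    using frechet_derivative_inner[OF diff_dF derivative_comp_\<phi>(1)[OF diff_d\<nu>[OF u]], of x e y]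
      derivative_comp_\<phi>(2)[OF diff_d\<nu>[OF u], of e y] by simp
  then show ?thesis
    by (simp add: dh_def d2f_tangent_null dF q d2\<nu>_sym[OF u, of e])
qed

text \<open>\<open>gauss_equation\<close> for \<open>f \<circ> \<phi>\<close> with \<open>w\<close>
  the normalized \<open>d\<nu> e\<close>. Normalizing divides each value of \<open>dh\<close> by the
  length of \<open>d\<nu> e\<close>, hence its square in the denominator.\<close>

lemma singular_curvature_numerator:
  assumes edges: "\<And>u. u \<in> singular_set U f \<Longrightarrow> \<exists>e. null_direction u e"
  shows "metric_at (induced_metric (f \<circ> \<phi>)) q (curvature_operator (induced_metric (f \<circ> \<phi>)) q x y y) x
    = (dh (\<phi> q) e (d\<phi> q x) (d\<phi> q x) * dh (\<phi> q) e (d\<phi> q y) (d\<phi> q y) - (dh (\<phi> q) e (d\<phi> q x) (d\<phi> q y))\<^sup>2)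
      / (norm (d\<nu> (\<phi> q) e))\<^sup>2"
proof -
  define n where "n = d\<nu> (\<phi> q) e"
  define w where "w = (1 / norm n) *\<^sub>R n"
  have n: "norm n \<noteq> 0" using d\<nu>_e_nonzero[OF null] by (simp add: n_def)
  have imm: "immersion_at (f \<circ> \<phi>) p" if "p \<in> V" for p
    using edges[OF \<phi>_singular[OF that]] immersion_F[OF that] by blast
  have dFw: "dF q x \<bullet> w = 0" for x
    using d\<nu>_e_normal(1)[OF null] by (simp add: w_def n_def dF q inner_commute)
  have normal: "z \<bullet> second_derivative (f \<circ> \<phi>) q x y = 0"
    if z: "\<And>v. z \<bullet> dF q v = 0" "z \<bullet> w = 0" for z x y
  proof -
    \<comment> \<open>Since \<open>df e\<close> vanishes, the image of \<open>df\<close> is already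
      that of \<open>dF\<close>.\<close>
    have "z \<bullet> df (\<phi> q) a = 0" for a
    proof -
      obtain b r where "a = d\<phi> q b + r *\<^sub>R e" using transversal_decomposition[OF q null] by blast
      then show ?thesis
        using z(1)[of b] df_e[OF null] linear_df[OF \<phi>_U[OF q]]
        by (simp add: dF q linear_add linear_scale)
    qed
    moreover have "z \<bullet> d\<nu> (\<phi> q) e = 0" using z(2) n by (simp add: w_def n_def)
    ultimately have "z = (z \<bullet> \<nu> (\<phi> q)) *\<^sub>R \<nu> (\<phi> q)" by (rule normal_space[OF null])
    then have "z \<bullet> second_derivative (f \<circ> \<phi>) q x y = (z \<bullet> \<nu> (\<phi> q)) * (\<nu> (\<phi> q) \<bullet> second_derivative (f \<circ> \<phi>) q x y)"
      by (metis inner_scaleR_left)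
    then show ?thesis using d2F_\<nu>[of x y] by (simp add: inner_commute)
  qed
  have \<beta>: "second_derivative (f \<circ> \<phi>) q a b \<bullet> w = dh (\<phi> q) e (d\<phi> q a) (d\<phi> q b) / norm n" for a b
    using d2F_d\<nu>[of a b] by (simp add: w_def n_def)
  show ?thesis
    using gauss_equation[OF open_V smooth_F imm q _ dFw normal, of x y] n
    unfolding \<beta> n_def[symmetric]
    by (simp add: w_def power2_eq_square diff_divide_distrib)
qed

end

end

end

theorem theorem5p1:
  fixes U :: "(real^'n::finite) set"
    and f \<nu> :: "real^'n \<Rightarrow> real^('n option)"
  assumes "CARD('n) \<ge> 3"
    and "CARD('n) = CARD('m::finite) + 1"
    and "open U" and "connected U" and "U \<noteq> {}"
    and "front_with U f \<nu>"
    and "\<forall>u \<in> singular_set U f. cuspidal_edge U f \<nu> u"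
  shows "((\<exists>C. \<forall>u \<in> regular_set U f. \<forall>x y. spans_plane x y \<longrightarrow>
              \<bar>sectional_curvature (induced_metric f) u x y\<bar> \<le> C) \<longrightarrow>
            (\<forall>u \<in> singular_set U f. \<forall>x y. second_fundamental_form f \<nu> u x y = 0)) \<and>
         ((\<forall>u \<in> regular_set U f. \<forall>x y. spans_plane x y \<longrightarrow>
              sectional_curvature (induced_metric f) u x y > 0) \<longrightarrow>
            (\<forall>V (\<phi> :: real^'m \<Rightarrow> real^'n). local_parametrization (singular_set U f) V \<phi> \<longrightarrow>
              (\<forall>q\<in>V. \<forall>x y. spans_plane x y \<longrightarrow>
                sectional_curvature (induced_metric (f \<circ> \<phi>)) q x y \<ge> 0))) \<and>
         ((\<exists>\<delta>>0. \<forall>u \<in> regular_set U f. \<forall>x y. spans_plane x y \<longrightarrow>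
              sectional_curvature (induced_metric f) u x y \<ge> \<delta>) \<longrightarrow>
            (\<forall>V (\<phi> :: real^'m \<Rightarrow> real^'n). local_parametrization (singular_set U f) V \<phi> \<longrightarrow>
              (\<forall>q\<in>V. \<forall>x y. spans_plane x y \<longrightarrow>
                sectional_curvature (induced_metric (f \<circ> \<phi>)) q x y > 0)))"
proof -
  interpret front U f \<nu> using assms by unfold_locales
  have edges: "\<exists>e. null_direction u e" if "u \<in> singular_set U f" for u
    using assms(7) cuspidal_edge_null_direction that by blast
  show ?thesis
  proof (intro conjI impI allI ballI)
    fix u x y :: "real^'n"
    assume bounded: "\<exists>C. \<forall>u \<in> regular_set U f. \<forall>x y. spans_plane x y \<longrightarrow>
      \<bar>sectional_curvature (induced_metric f) u x y\<bar> \<le> C" and u: "u \<in> singular_set U f"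
    obtain e where "null_direction u e" using edges[OF u] by blast
    then show "second_fundamental_form f \<nu> u x y = 0"
      using bounded bounded_curvature_imp_h_zero by blast
  next
    fix V and \<phi> :: "real^'m \<Rightarrow> real^'n" and q x y :: "real^'m"
    assume K: "\<forall>u \<in> regular_set U f. \<forall>x y. spans_plane x y \<longrightarrow>
        sectional_curvature (induced_metric f) u x y > 0"
      and param: "local_parametrization (singular_set U f) V \<phi>" and q: "q \<in> V" and xy: "spans_plane x y"
    obtain e where e: "null_direction (\<phi> q) e" using edges[OF \<phi>_singular[OF assms(2) param q]] by blast
    have flat: "second_fundamental_form f \<nu> u a b = 0" if "u \<in> singular_set U f" for u a b
      using edges[OF that] positive_curvature_imp_h_zero K by blast
    have "spans_plane (frechet_derivative \<phi> (at q) x) (frechet_derivative \<phi> (at q) y)"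
      using linear_d\<phi>[OF assms(2) param q] inj_d\<phi>[OF assms(2) param q] xy by (rule spans_plane_linear_image)
    then have "dh (\<phi> q) e (frechet_derivative \<phi> (at q) x) (frechet_derivative \<phi> (at q) x) *
        dh (\<phi> q) e (frechet_derivative \<phi> (at q) y) (frechet_derivative \<phi> (at q) y) -
        (dh (\<phi> q) e (frechet_derivative \<phi> (at q) x) (frechet_derivative \<phi> (at q) y))\<^sup>2 \<ge> 0"
      using positive_curvature_imp_dh_minor_nonneg[OF e] K by blast
    then have "metric_at (induced_metric (f \<circ> \<phi>)) q (curvature_operator (induced_metric (f \<circ> \<phi>)) q x y y) x \<ge> 0"
      by (subst singular_curvature_numerator[OF assms(2) param q e]) (simp_all add: flat edges)
    moreover have imm: "immersion_at (f \<circ> \<phi>) q" by (rule immersion_F[OF assms(2) param q e])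
    then have "spans_plane (frechet_derivative (f \<circ> \<phi>) (at q) x) (frechet_derivative (f \<circ> \<phi>) (at q) y)"
      unfolding immersion_at_def by (metis xy spans_plane_linear_image linear_frechet_derivative)
    \<comment> \<open>This is the denominator of the sectional curvature, so the numerator decides
      the sign.\<close>
    note gram_pos[OF this]
    ultimately show "sectional_curvature (induced_metric (f \<circ> \<phi>)) q x y \<ge> 0"
      using imm unfolding sectional_curvature_def immersion_at_def
      by (intro divide_nonneg_nonneg) (auto simp: metric_at_induced_metric)
  next
    fix V and \<phi> :: "real^'m \<Rightarrow> real^'n" and q x y :: "real^'m"
    assume K: "\<exists>\<delta>>0. \<forall>u \<in> regular_set U f. \<forall>x y. spans_plane x y \<longrightarrow>
        sectional_curvature (induced_metric f) u x y \<ge> \<delta>"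
      and param: "local_parametrization (singular_set U f) V \<phi>" and q: "q \<in> V" and xy: "spans_plane x y"
    obtain e where e: "null_direction (\<phi> q) e" using edges[OF \<phi>_singular[OF assms(2) param q]] by blast
    have "immersion_at (f \<circ> \<phi>) q" by (rule immersion_F[OF assms(2) param q e])
    then have "spans_plane (frechet_derivative (f \<circ> \<phi>) (at q) x) (frechet_derivative (f \<circ> \<phi>) (at q) y)"
      unfolding immersion_at_def by (metis xy spans_plane_linear_image linear_frechet_derivative)
    \<comment> \<open>The bound \<open>\<delta>\<close> contradicts the existence of the singular
      point \<open>\<phi> q\<close>, so the inequality holds vacuously.\<close>
    then show "sectional_curvature (induced_metric (f \<circ> \<phi>)) q x y > 0"
      unfolding dF[OF assms(2) param q] using no_positive_lower_curvature_bound[OF e] K by blast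
  qed
qed

end
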